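(* Consider any of the three picking systems Pcart-N, Pcart, Robot. Fix $t>0$. For $\lambda>0$ let $\mathbb{P}_\lambda$ (with expectation $\mathbb{E}_\lambda$) be the probability measure under which the orders $O_1,O_2,\ldots$ are i.i.d. random orders (with a distribution not depending on $\lambda$), the order arrival times form a homogeneous Poisson process with rate $\lambda$, and orders and arrival times are independent; in the case of Robot assume in addition that the number $K_1$ of picking locations of $O_1$ satisfies $\mathbb{E}[K_1]>1$. Let $I(t)^{rand}$ be the random instance consisting of the orders that arrive in the time interval $[0,t]$. Let $(\lambda_i)_{i\in\mathbb{N}}$, $\lambda_i>0$, be any increasing sequence of arrival rates with $\lambda_i\to\infty$ as $i\to\infty$. Then $$\lim_{i\to\infty}\mathbb{E}_{\lambda_i}\left[\frac{Reopt(I(t)^{rand})}{CIOPT(I(t)^{rand})}\right]=1,$$ and for all $\epsilon>0$ $$\lim_{i\to\infty}\mathbb{P}_{\lambda_i}\left(\frac{Reopt(I(t)^{rand})}{CIOPT(I(t)^{rand})}\ge 1+\epsilon\right)=0.$$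
   Context: Warehouse. A warehouse is a rectilinear grid of length $L$ and width $W$ consisting of $a\ge 1$ equidistant parallel (vertical) aisles, each a segment of length $W$, and $b\ge 2$ equidistant (horizontal) cross-aisles, each a segment of length $L$; the outermost aisles and cross-aisles form the border of the grid (for $a=1$, $L=0$). The picker moves along aisles and cross-aisles at unit speed (and may wait); $d$ is the resulting shortest-path metric. The depot $l_d$ is a fixed point of the grid. Picking locations are points in aisles. The infrastructure ($W,L,a,b,l_d$ and the batching capacity $c\in\mathbb{N}$) is fixed. Instance. An instance $I$ consists of the infrastructure, a sequence of orders $o_1,\ldots,o_n$, where $o_j=\{s_j^1,\ldots,s_j^{k(j)}\}$ is a set of $k(j)\ge1$ picking locations (items), and arrival times $0\le r_1\le\ldots\le r_n$. The picker starts at $l_d$ at time 0. A solution partitions the orders into batches of at most $c$ orders, sequences the batches, and fixes for each batch a visiting sequence of all picking locations of its orders. Batches are processed one after another; an item of $o_j$ cannot be picked before $r_j$; picking itself takes zero time; an order cannot be split between batches. With a pushcart, every batch starts at the depot and ends with the picker's return to the depot, and the objective (total completion time) is the time of the final return to the depot. With a robot, the picker starts the next batch from the location where she picked the last item of the previous batch (a new empty robot is immediately available there), and the objective is the time at which the last item is picked. $CIOPT(I)$ is the minimum objective value when the whole instance is known in advance (the picker may then move towards locations of orders that have not arrived yet). Online policy Reopt and the three systems. Online, the number of orders is unknown and each order (with its picking locations) becomes known only at its arrival time. Reopt never anticipates future orders; when it reoptimizes at time $t'$, it computes a plan with minimal total completion time for the orders that have arrived by $t'$ and have not been completely picked, treating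 them as immediately available, and follows this plan until the next reoptimization; if there is nothing left to do, the picker stays where she is (at the depot initially and in the pushcart systems). - Pcart-N (pushcart, non-interventionist Reopt): reoptimization takes place only when the picker is at the depot (on each return to the depot if new orders have arrived, or on arrival of an order while she is idle at the depot); started batches cannot be modified. - Pcart (pushcart, interventionist Reopt) and Robot (robot, interventionist Reopt): reoptimization takes place at every order arrival; the plan starts from the picker's current position, orders having at least one item already in the current cart must be completed as part of the current batch, and all other bins of the current cart (of $c$ bins, one order per bin) can be freely (re)assigned to not yet commenced orders. Ties between optimal plans are broken by an arbitrary fixed deterministic rule. $Reopt(I)$ is the resulting total completion time (pushcart or robot objective according to the system), and $CIOPT(I)$ is taken for the same cart type. Stochastic conventions. A random order is $O_j=(K_j,S_j^1,\ldots,S_j^{K_j})$ with $K_j$ the number of its (distinct) picking locations $S_j^1,\ldots,S_j^{K_j}$; locations within the same order may be arbitrarily dependent. $Reopt(\cdot)$ and $CIOPT(\cdot)$ are regarded as measurable functions of the random instance. Convention: a ratio $0/0$ (e.g. if no order arrives in $[0,t]$) equals 1. *)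

theory Defs
  imports "HOL-Probability.Probability"
begin

type_synonym point = "real \<times> real"

record warehouse =
  wh_length :: real
  wh_width :: real
  wh_aisles :: nat
  wh_cross :: nat
  depot :: point
  capacity :: nat

definition aisles :: "warehouse \<Rightarrow> point set" where
  "aisles w = (\<Union>i<wh_aisles w.
     {real i * wh_length w / real (wh_aisles w - 1)} \<times> {0..wh_width w})"

definition cross_aisles :: "warehouse \<Rightarrow> point set" where
  "cross_aisles w = (\<Union>k<wh_cross w.
     {0..wh_length w} \<times> {real k * wh_width w / real (wh_cross w - 1)})"

definition grid :: "warehouse \<Rightarrow> point set" where
  "grid w = aisles w \<union> cross_aisles w"

definition valid_warehouse :: "warehouse \<Rightarrow> bool" where
  "valid_warehouse w \<longleftrightarrow>
     1 \<le> wh_aisles w \<and> 2 \<le> wh_cross w \<and> 0 < wh_width w \<and>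
     (if wh_aisles w = 1 then wh_length w = 0 else 0 < wh_length w) \<and>
     depot w \<in> grid w \<and> 1 \<le> capacity w"

text \<open>A motion of a picker with speed at most one (she may wait) is a 1-Lipschitz curve in the grid,
  parametrised by time. The distance is the least travel time.\<close>

definition sp_dist :: "warehouse \<Rightarrow> point \<Rightarrow> point \<Rightarrow> real" where
  "sp_dist w p q = Inf {T. 0 \<le> T \<and>
     (\<exists>\<gamma>. lipschitz_on 1 {0..T} \<gamma> \<and> \<gamma> ` {0..T} \<subseteq> grid w \<and> \<gamma> 0 = p \<and> \<gamma> T = q)}"

text \<open>An order is the duplicate-free list of its picking locations; an instance lists the pairs of
  arrival time and order by nondecreasing arrival time. Orders are identified by their index in
  this list, and the item of order \<open>j\<close> at location \<open>p\<close> is the pair \<open>(j, p)\<close>.\<close>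

type_synonym order = "point list"
type_synonym inst = "(real \<times> order) list"
type_synonym item = "nat \<times> point"

definition valid_order :: "warehouse \<Rightarrow> order \<Rightarrow> bool" where
  "valid_order w ps \<longleftrightarrow> ps \<noteq> [] \<and> distinct ps \<and> set ps \<subseteq> aisles w"

definition items :: "inst \<Rightarrow> item set" where
  "items I = {(j, p). j < length I \<and> p \<in> set (snd (I ! j))}"

datatype system = PcartN | Pcart | Robot

text \<open>A batch is given by the visiting sequence of its items. Following a list of batches amounts to a
  sequence of steps, where \<open>Close\<close> ends a batch: a pushcart is brought back to the depot, whereas a
  robot is replaced on the spot.\<close>

datatype step = Pick item | Close

definition steps :: "item list list \<Rightarrow> step list" where
  "steps bs = concat (map (\<lambda>b. map Pick b @ [Close]) bs)"

fun dest :: "warehouse \<Rightarrow> system \<Rightarrow> point \<Rightarrow> step \<Rightarrow> point" where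
  "dest w sys p (Pick x) = snd x"
| "dest w sys p Close = (if sys = Robot then p else depot w)"

primrec duration :: "warehouse \<Rightarrow> system \<Rightarrow> point \<Rightarrow> step list \<Rightarrow> real" where
  "duration w sys p [] = 0"
| "duration w sys p (e # es) =
     sp_dist w p (dest w sys p e) + duration w sys (dest w sys p e) es"

definition orders_of :: "item list \<Rightarrow> nat set" where
  "orders_of b = fst ` set b"

text \<open>The batches contain every item of \<open>Q\<close> exactly once, and no order is split.\<close>

definition batching :: "item set \<Rightarrow> item list list \<Rightarrow> bool" where
  "batching Q bs \<longleftrightarrow> distinct (concat bs) \<and> set (concat bs) = Q \<and>
     sorted_wrt (\<lambda>b b'. orders_of b \<inter> orders_of b' = {}) bs"


subsection \<open>Complete information\<close>

definition solution :: "warehouse \<Rightarrow> inst \<Rightarrow> item list list \<Rightarrow> bool" where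
  "solution w I bs \<longleftrightarrow> batching (items I) bs \<and>
     (\<forall>b\<in>set bs. b \<noteq> [] \<and> card (orders_of b) \<le> capacity w)"

text \<open>Completion time of a sequence of steps started at \<open>p\<close> at time \<open>\<tau>\<close>; the picker may
  reach a location early and waits there until the order arrives.\<close>

fun completion :: "warehouse \<Rightarrow> system \<Rightarrow> inst \<Rightarrow> point \<Rightarrow> real \<Rightarrow> step list \<Rightarrow> real" where
  "completion w sys I p \<tau> [] = \<tau>"
| "completion w sys I p \<tau> (Pick x # es) =
     completion w sys I (snd x) (max (\<tau> + sp_dist w p (snd x)) (fst (I ! fst x))) es"
| "completion w sys I p \<tau> (Close # es) =
     completion w sys I (dest w sys p Close) (\<tau> + sp_dist w p (dest w sys p Close)) es"

definition ciopt :: "warehouse \<Rightarrow> system \<Rightarrow> inst \<Rightarrow> real" where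
  "ciopt w sys I = Min {completion w sys I (depot w) 0 (steps bs) | bs. solution w I bs}"


subsection \<open>Reoptimization\<close>

text \<open>The situation of the online picker at a reoptimization: \<open>known\<close> is the part of the
  instance that has been revealed, \<open>cart\<close> consists of the orders with at least one item in the
  current cart (completely picked or not; each of them occupies a bin), and \<open>pending\<close> consists of
  the revealed items that have not been picked.\<close>

record situation =
  clock :: real
  known :: inst
  pos :: point
  cart :: "nat set"
  pending :: "item set"

text \<open>The head of the list is the (possibly empty) remainder of the current batch.\<close>

definition feasible :: "warehouse \<Rightarrow> situation \<Rightarrow> item list list \<Rightarrow> bool" where
  "feasible w s bs \<longleftrightarrow> bs \<noteq> [] \<and> batching (pending s) bs \<and>
     card (cart s \<union> orders_of (hd bs)) \<le> capacity w \<and>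
     (\<forall>b\<in>set (tl bs). b \<noteq> [] \<and> orders_of b \<inter> cart s = {} \<and> card (orders_of b) \<le> capacity w)"

text \<open>The picker's position as a function of the time elapsed: she goes from each stop to the next
  along a shortest path, without delay, and stays at the last one. The path matters because an
  intervention may find her between two stops.\<close>

definition route :: "warehouse \<Rightarrow> system \<Rightarrow> point \<Rightarrow> step list \<Rightarrow> (real \<Rightarrow> point) \<Rightarrow> bool" where
  "route w sys p es \<gamma> \<longleftrightarrow>
     lipschitz_on 1 {0..} \<gamma> \<and> \<gamma> ` {0..} \<subseteq> grid w \<and>
     (\<forall>k\<le>length es. \<gamma> (duration w sys p (take k es)) = foldl (dest w sys) p (take k es)) \<and>
     (\<forall>u\<ge>duration w sys p es. \<gamma> u = foldl (dest w sys) p es)"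

type_synonym plan = "item list list \<times> (real \<Rightarrow> point)"

definition optimal_plan :: "warehouse \<Rightarrow> system \<Rightarrow> situation \<Rightarrow> plan \<Rightarrow> bool" where
  "optimal_plan w sys s \<pi> \<longleftrightarrow>
     feasible w s (fst \<pi>) \<and> route w sys (pos s) (steps (fst \<pi>)) (snd \<pi>) \<and>
     (\<forall>bs. feasible w s bs \<longrightarrow>
        duration w sys (pos s) (steps (fst \<pi>)) \<le> duration w sys (pos s) (steps bs))"

text \<open>A deterministic way of choosing among the optimal plans, based on revealed information only.\<close>

definition tie_breaking :: "warehouse \<Rightarrow> system \<Rightarrow> (situation \<Rightarrow> plan) \<Rightarrow> bool" where
  "tie_breaking w sys sel \<longleftrightarrow>
     (\<forall>s. (\<exists>\<pi>. optimal_plan w sys s \<pi>) \<longrightarrow> optimal_plan w sys s (sel s))"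

text \<open>Cart and unpicked items after following the steps for \<open>u\<close> time units from the stop \<open>p\<close>.\<close>

fun advance :: "warehouse \<Rightarrow> system \<Rightarrow> real \<Rightarrow> point \<Rightarrow> step list \<Rightarrow>
    nat set \<Rightarrow> item set \<Rightarrow> nat set \<times> item set" where
  "advance w sys u p [] C Q = (C, Q)"
| "advance w sys u p (Pick x # es) C Q =
     (if sp_dist w p (snd x) \<le> u
      then advance w sys (u - sp_dist w p (snd x)) (snd x) es (insert (fst x) C) (Q - {x})
      else (C, Q))"
| "advance w sys u p (Close # es) C Q =
     (let q = dest w sys p Close in
      if sp_dist w p q \<le> u then advance w sys (u - sp_dist w p q) q es {} Q else (C, Q))"

text \<open>Non-interventionist case: the batches are performed from the depot from time \<open>\<tau>\<close> on, and the
  next order arrives at time \<open>r\<close>. The result consists of the first time from \<open>r\<close> on at which the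
  picker is at the depot between batches (or idle), and of the batches not started by then.\<close>

fun serve :: "warehouse \<Rightarrow> real \<Rightarrow> item list list \<Rightarrow> real \<Rightarrow> real \<times> item list list" where
  "serve w \<tau> [] r = (max \<tau> r, [])"
| "serve w \<tau> (b # bs) r =
     (if r \<le> \<tau> then (\<tau>, b # bs)
      else serve w (\<tau> + duration w PcartN (depot w) (steps [b])) bs r)"

text \<open>The situation in which the next reoptimization takes place if the plan \<open>\<pi>\<close> is followed from
  situation \<open>s\<close> and the next order arrives at time \<open>r\<close> (new orders not yet entered).\<close>

definition follow :: "warehouse \<Rightarrow> system \<Rightarrow> plan \<Rightarrow> real \<Rightarrow> situation \<Rightarrow> situation" where
  "follow w sys \<pi> r s =
     (if sys = PcartN
      then let (\<tau>, bs) = serve w (clock s) (fst \<pi>) r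
           in s\<lparr>clock := \<tau>, pending := set (concat bs)\<rparr>
      else let u = r - clock s;
               (C, Q) = advance w sys u (pos s) (steps (fst \<pi>)) (cart s) (pending s)
           in s\<lparr>clock := r, pos := snd \<pi> u, cart := C, pending := Q\<rparr>)"

definition reveal :: "inst \<Rightarrow> situation \<Rightarrow> situation" where
  "reveal I s = (let K = takeWhile (\<lambda>x. fst x \<le> clock s) I in
     s\<lparr>known := K,
       pending := pending s \<union> {x \<in> items K. length (known s) \<le> fst x}\<rparr>)"

primrec run :: "warehouse \<Rightarrow> system \<Rightarrow> (situation \<Rightarrow> plan) \<Rightarrow> inst \<Rightarrow>
    real list \<Rightarrow> situation \<Rightarrow> real" where
  "run w sys sel I [] s = clock s + duration w sys (pos s) (steps (fst (sel s)))"
| "run w sys sel I (r # rs) s =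
     run w sys sel I rs
       (if r \<le> clock s then s else reveal I (follow w sys (sel s) r s))"

definition reopt :: "warehouse \<Rightarrow> system \<Rightarrow> (situation \<Rightarrow> plan) \<Rightarrow> inst \<Rightarrow> real" where
  "reopt w sys sel I = run w sys sel I (map fst I)
     (reveal I \<lparr>clock = 0, known = [], pos = depot w, cart = {}, pending = {}\<rparr>)"

definition ratio :: "real \<Rightarrow> real \<Rightarrow> real" where
  "ratio x y = (if x = 0 \<and> y = 0 then 1 else x / y)"


subsection \<open>Random instances\<close>

text \<open>The sigma-algebra generated by the number of locations and by the individual locations
  (padded by the origin).\<close>

definition order_space :: "order measure" where
  "order_space = vimage_algebra UNIV
     (\<lambda>ps. (length ps, \<lambda>k. if k < length ps then ps ! k else (0, 0)))
     (count_space UNIV \<Otimes>\<^sub>M (\<Pi>\<^sub>M k\<in>(UNIV :: nat set). (borel :: point measure)))"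

definition interarrival :: "(nat \<Rightarrow> 'w \<Rightarrow> real) \<Rightarrow> nat \<Rightarrow> 'w \<Rightarrow> real" where
  "interarrival R j \<omega> = (if j = 0 then R 0 \<omega> else R j \<omega> - R (j - 1) \<omega>)"

definition poisson_arrivals :: "'w measure \<Rightarrow> real \<Rightarrow> (nat \<Rightarrow> 'w \<Rightarrow> real) \<Rightarrow> bool" where
  "poisson_arrivals M l R \<longleftrightarrow>
     prob_space.indep_vars M (\<lambda>_. borel) (interarrival R) UNIV \<and>
     (\<forall>j. distributed M lborel (interarrival R j) (exponential_density l))"

definition order_stream ::
  "'w measure \<Rightarrow> real \<Rightarrow> order measure \<Rightarrow> (nat \<Rightarrow> 'w \<Rightarrow> order) \<Rightarrow> (nat \<Rightarrow> 'w \<Rightarrow> real) \<Rightarrow> bool" where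
  "order_stream M l D Ord R \<longleftrightarrow>
     prob_space M \<and>
     prob_space.indep_vars M (\<lambda>_. order_space) Ord UNIV \<and>
     (\<forall>j. distr M order_space (Ord j) = D) \<and>
     poisson_arrivals M l R \<and>
     prob_space.indep_set M
       {(\<lambda>\<omega> j. Ord j \<omega>) -` A \<inter> space M | A. A \<in> sets (\<Pi>\<^sub>M j\<in>(UNIV :: nat set). order_space)}
       {(\<lambda>\<omega> j. R j \<omega>) -` A \<inter> space M | A. A \<in> sets (\<Pi>\<^sub>M j\<in>(UNIV :: nat set). (borel :: real measure))}"

text \<open>Almost surely the arrival times are increasing and only finitely many of them are at most \<open>t\<close>,
  so that these are the first ones.\<close>

definition random_inst :: "(nat \<Rightarrow> 'w \<Rightarrow> order) \<Rightarrow> (nat \<Rightarrow> 'w \<Rightarrow> real) \<Rightarrow> real \<Rightarrow> 'w \<Rightarrow> inst" where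
  "random_inst Ord R t \<omega> = map (\<lambda>j. (R j \<omega>, Ord j \<omega>)) [0..<card {j. R j \<omega> \<le> t}]"

end

theory Submission
  imports
    Defs
    "HOL-Library.Sublist"
    "HOL-Complex_Analysis.Great_Picard"
begin

text \<open>
  The whole argument rests on two facts about a single instance.

  First, reoptimization loses at most a constant: all orders are known at the latest when the last
  of them has arrived and, without intervention, the running batch is over. From then on the
  picker could finish the orders in her cart by one sweep through all aisles and then copy the
  batches of an optimal solution of the complete instance, restricted to what is still missing. Reopt
  is at least as good as that, so \<open>Reopt \<le> CIOPT + t + C\<close>, where \<open>C\<close> depends on the warehouse only
  (\<open>reopt_le_ciopt_plus_const\<close>).

  Secondly, \<open>CIOPT\<close> grows with the number of orders. Call an order spread if it forces some
  travel of length \<open>\<delta>\<close> on every batch that contains it. A batch holds at most \<open>c\<close> orders, whence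
  \<open>CIOPT \<ge> \<delta> N / c\<close> for \<open>N\<close> spread orders (\<open>ciopt_ge_spread\<close>). With a pushcart, an order is spread as
  soon as it has a location away from the depot, because every batch ends there. With a robot, only two
  different locations of the same order force a movement, and \<open>E[K] > 1\<close> says that they occur
  with positive probability.

  So the ratio is at most \<open>1 + (t + C) / CIOPT\<close>, and \<open>CIOPT\<close> tends to infinity in probability
  as the rate does: for fixed \<open>n\<close> the first \<open>n\<close> orders arrive before \<open>t\<close> with probability tending
  to one, and many of them are spread if \<open>n\<close> is large. If no \<open>\<delta>\<close> gives a positive probability of a
  spread order, which is possible with a pushcart only, then almost surely all locations are at the depot and
  both policies finish with the last arrival.

  To pass to expectations, the ratio has to be bounded also on the unlikely instances in which
  \<open>CIOPT\<close> is close to zero. Copying the optimal solution also for the orders in the cart instead of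
  sweeping the aisles yields the crude but sufficient \<open>Reopt \<le> 11 CIOPT\<close> (\<open>reopt_competitive\<close>). The
  ratio is at least one because the online run itself performs a solution of the instance
  (\<open>ciopt_le_reopt\<close>), and so the statement on probabilities follows by Markov's inequality.
\<close>

section \<open>Shortest paths in the grid\<close>

definition reach :: "warehouse \<Rightarrow> point \<Rightarrow> point \<Rightarrow> real \<Rightarrow> bool" where
  "reach w p q T \<longleftrightarrow> 0 \<le> T \<and>
     (\<exists>\<gamma>. lipschitz_on 1 {0..T} \<gamma> \<and> \<gamma> ` {0..T} \<subseteq> grid w \<and> \<gamma> 0 = p \<and> \<gamma> T = q)"

lemma sp_dist_reach: "sp_dist w p q = Inf {T. reach w p q T}"
  by (simp add: sp_dist_def reach_def)

lemma reach_refl: "p \<in> grid w \<Longrightarrow> reach w p p 0"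
  by (auto simp: reach_def intro!: exI[of _ "\<lambda>_. p"])

lemma reach_sym:
  assumes "reach w p q T" shows "reach w q p T"
proof -
  obtain \<gamma> where T: "0 \<le> T" and \<gamma>: "lipschitz_on 1 {0..T} \<gamma>" "\<gamma> ` {0..T} \<subseteq> grid w" "\<gamma> 0 = p" "\<gamma> T = q"
    using assms by (auto simp: reach_def)
  have "lipschitz_on 1 {0..T} (\<lambda>t. \<gamma> (T - t))"
  proof (rule lipschitz_onI)
    fix x y assume "x \<in> {0..T}" "y \<in> {0..T}"
    then have "dist (\<gamma> (T - x)) (\<gamma> (T - y)) \<le> 1 * dist (T - x) (T - y)"
      by (intro lipschitz_onD[OF \<gamma>(1)]) auto
    then show "dist (\<gamma> (T - x)) (\<gamma> (T - y)) \<le> 1 * dist x y"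
      by (simp add: dist_real_def)
  qed simp
  moreover have "(\<lambda>t. \<gamma> (T - t)) ` {0..T} \<subseteq> grid w"
    using \<gamma>(2) by auto
  ultimately show ?thesis
    unfolding reach_def using T \<gamma> by (intro conjI exI[of _ "\<lambda>t. \<gamma> (T - t)"]) auto
qed

lemma reach_trans:
  assumes "reach w p q T" "reach w q r U" shows "reach w p r (T + U)"
proof -
  obtain \<gamma> where T: "0 \<le> T" and \<gamma>: "lipschitz_on 1 {0..T} \<gamma>" "\<gamma> ` {0..T} \<subseteq> grid w" "\<gamma> 0 = p" "\<gamma> T = q"
    using assms by (auto simp: reach_def)
  obtain \<eta> where U: "0 \<le> U" and \<eta>: "lipschitz_on 1 {0..U} \<eta>" "\<eta> ` {0..U} \<subseteq> grid w" "\<eta> 0 = q" "\<eta> U = r"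
    using assms by (auto simp: reach_def)
  have "lipschitz_on 1 {T..T+U} (\<lambda>t. \<eta> (t - T))"
  proof (rule lipschitz_onI)
    fix x y assume "x \<in> {T..T+U}" "y \<in> {T..T+U}"
    then have "dist (\<eta> (x - T)) (\<eta> (y - T)) \<le> 1 * dist (x - T) (y - T)"
      by (intro lipschitz_onD[OF \<eta>(1)]) auto
    then show "dist (\<eta> (x - T)) (\<eta> (y - T)) \<le> 1 * dist x y"
      by (simp add: dist_real_def)
  qed simp
  then have L: "lipschitz_on 1 {0..T+U} (\<lambda>t. if t \<le> T then \<gamma> t else \<eta> (t - T))"
    using \<gamma> \<eta> by (intro lipschitz_on_concat) auto
  have "(\<lambda>t. if t \<le> T then \<gamma> t else \<eta> (t - T)) ` {0..T+U} \<subseteq> grid w"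
    using \<gamma>(2) \<eta>(2) by (auto simp: image_subset_iff)
  with L show ?thesis
    unfolding reach_def using T U \<gamma> \<eta>
    by (intro conjI exI[of _ "\<lambda>t. if t \<le> T then \<gamma> t else \<eta> (t - T)"]) auto
qed

text \<open>Straight lines traversed at unit speed; in the grid they are available along aisles and
  cross-aisles.\<close>
lemma reach_segment:
  assumes "closed_segment p q \<subseteq> grid w" shows "reach w p q (dist p q)"
proof (cases "p = q")
  case True then show ?thesis using assms reach_refl by auto
next
  case False
  define D where "D = dist p q"
  have D: "D > 0" using False by (simp add: D_def)
  define \<gamma> where "\<gamma> t = p + (t / D) *\<^sub>R (q - p)" for t
  have "lipschitz_on 1 {0..D} \<gamma>"
  proof (rule lipschitz_onI)
    fix x y :: real
    have "\<gamma> x - \<gamma> y = ((x - y) / D) *\<^sub>R (q - p)"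
      by (simp add: \<gamma>_def scaleR_left_diff_distrib diff_divide_distrib)
    then show "dist (\<gamma> x) (\<gamma> y) \<le> 1 * dist x y"
      using D by (simp add: dist_norm D_def norm_minus_commute)
  qed simp
  moreover have "\<gamma> ` {0..D} \<subseteq> closed_segment p q"
  proof (rule image_subsetI)
    fix t assume t: "t \<in> {0..D}"
    have "\<gamma> t = (1 - t/D) *\<^sub>R p + (t/D) *\<^sub>R q"
      by (simp add: \<gamma>_def algebra_simps)
    then show "\<gamma> t \<in> closed_segment p q"
      unfolding closed_segment_def using t D by (auto intro!: exI[of _ "t/D"])
  qed
  moreover have "\<gamma> 0 = p" "\<gamma> D = q" using D by (auto simp: \<gamma>_def)
  ultimately show ?thesis
    unfolding reach_def D_def[symmetric] using D assms by (intro conjI exI[of _ \<gamma>]) auto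
qed

lemma dist_le_reach:
  assumes "reach w p q T" shows "dist p q \<le> T"
proof -
  obtain \<gamma> where T: "0 \<le> T" and \<gamma>: "lipschitz_on 1 {0..T} \<gamma>" "\<gamma> 0 = p" "\<gamma> T = q"
    using assms by (auto simp: reach_def)
  have "dist (\<gamma> 0) (\<gamma> T) \<le> 1 * dist 0 T" using T by (intro lipschitz_onD[OF \<gamma>(1)]) auto
  then show ?thesis using \<gamma> T by (simp add: dist_real_def)
qed

locale warehouse_grid =
  fixes w :: warehouse
  assumes valid: "valid_warehouse w"
begin

abbreviation d where "d \<equiv> sp_dist w"
abbreviation G where "G \<equiv> grid w"

definition diam :: real where "diam = 2 * (wh_length w + wh_width w)"

lemma W_pos: "0 < wh_width w" and L_nonneg: "0 \<le> wh_length w"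
  and cap_pos: "1 \<le> capacity w" and depot_grid: "depot w \<in> G"
  using valid by (auto simp: valid_warehouse_def split: if_splits)

lemma aisles_grid: "aisles w \<subseteq> G" by (simp add: grid_def)

text \<open>From an aisle one walks down to the lowest cross-aisle and along it to the origin; from a
  cross-aisle, along it to the leftmost aisle and down. In particular the grid is connected, and distances
  in it are bounded.\<close>
lemma grid_reach_origin:
  assumes "p \<in> G" shows "\<exists>T \<le> wh_length w + wh_width w. reach w p (0,0) T"
proof -
  let ?L = "wh_length w" and ?W = "wh_width w"
  let ?A = "\<lambda>x. {x} \<times> {0..?W}" and ?C = "\<lambda>y. {0..?L} \<times> {y}"
  have a0: "?A 0 \<subseteq> G"
  proof -
    have "0 < wh_aisles w" using valid by (auto simp: valid_warehouse_def)
    then have "?A 0 \<subseteq> aisles w" unfolding aisles_def by (intro UN_upper[of 0, THEN order_trans[rotated]]) auto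
    then show ?thesis by (auto simp: grid_def)
  qed
  have c0: "?C 0 \<subseteq> G"
  proof -
    have "0 < wh_cross w" using valid by (auto simp: valid_warehouse_def)
    then have "?C 0 \<subseteq> cross_aisles w" unfolding cross_aisles_def by (intro UN_upper[of 0, THEN order_trans[rotated]]) auto
    then show ?thesis by (auto simp: grid_def)
  qed
  from assms consider "p \<in> aisles w" | "p \<in> cross_aisles w" by (auto simp: grid_def)
  then show ?thesis
  proof cases
    case 1
    then obtain i where i: "i < wh_aisles w" and p: "fst p = real i * ?L / real (wh_aisles w - 1)" "snd p \<in> {0..?W}"
      by (auto simp: aisles_def)
    have "?A (fst p) \<subseteq> G" using i p by (auto simp: grid_def aisles_def)
    moreover have "closed_segment p (fst p, 0) \<subseteq> ?A (fst p)"
      using p W_pos by (intro closed_segment_subset convex_Times) (auto simp: mem_Times_iff)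
    ultimately have 1: "reach w p (fst p, 0) (dist p (fst p, 0))"
      by (intro reach_segment) blast
    have x: "fst p \<in> {0..?L}"
    proof (cases "wh_aisles w = 1")
      case True then show ?thesis using p i L_nonneg by auto
    next
      case False
      then have "real i / real (wh_aisles w - 1) \<le> 1" using i by (auto simp: divide_simps)
      then have "?L * (real i / real (wh_aisles w - 1)) \<le> ?L * 1" using L_nonneg by (intro mult_left_mono) auto
      then show ?thesis using p L_nonneg by (auto simp: mult.commute)
    qed
    then have "closed_segment (fst p, 0) (0,0) \<subseteq> ?C 0"
      using L_nonneg by (intro closed_segment_subset convex_Times) auto
    with c0 have 2: "reach w (fst p, 0) (0,0) (dist (fst p, 0::real) (0,0))"
      by (intro reach_segment) blast
    have "dist p (fst p, 0) \<le> ?W" using p by (cases p) (auto simp: dist_Pair_Pair dist_real_def)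
    moreover have "dist (fst p, 0::real) (0,0) \<le> ?L" using x by (auto simp: dist_Pair_Pair dist_real_def)
    ultimately show ?thesis using reach_trans[OF 1 2] by (intro exI conjI) (auto simp: algebra_simps)
  next
    case 2
    then obtain i where i: "i < wh_cross w" and p: "snd p = real i * ?W / real (wh_cross w - 1)" "fst p \<in> {0..?L}"
      by (auto simp: cross_aisles_def)
    have "?C (snd p) \<subseteq> G" using i p by (auto simp: grid_def cross_aisles_def)
    moreover have "closed_segment p (0, snd p) \<subseteq> ?C (snd p)"
      using p L_nonneg by (intro closed_segment_subset convex_Times) (auto simp: mem_Times_iff)
    ultimately have 1: "reach w p (0, snd p) (dist p (0, snd p))"
      by (intro reach_segment) blast
    have x: "snd p \<in> {0..?W}"
    proof -
      have "wh_cross w \<ge> 2" using valid by (auto simp: valid_warehouse_def)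
      then have "real i / real (wh_cross w - 1) \<le> 1" using i by (auto simp: divide_simps)
      then have "?W * (real i / real (wh_cross w - 1)) \<le> ?W * 1" using W_pos by (intro mult_left_mono) auto
      then show ?thesis using p W_pos by (auto simp: mult.commute)
    qed
    then have "closed_segment (0, snd p) (0,0) \<subseteq> ?A 0"
      using W_pos by (intro closed_segment_subset convex_Times) auto
    with a0 have 2: "reach w (0, snd p) (0,0) (dist (0::real, snd p) (0,0))"
      by (intro reach_segment) blast
    have "dist p (0, snd p) \<le> ?L" using p by (cases p) (auto simp: dist_Pair_Pair dist_real_def)
    moreover have "dist (0::real, snd p) (0,0) \<le> ?W" using x by (auto simp: dist_Pair_Pair dist_real_def)
    ultimately show ?thesis using reach_trans[OF 1 2] by (intro exI conjI) (auto simp: algebra_simps)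
  qed
qed

lemma grid_reach:
  assumes "p \<in> G" "q \<in> G" shows "\<exists>T \<le> diam. reach w p q T"
proof -
  obtain T U where "T \<le> wh_length w + wh_width w" "U \<le> wh_length w + wh_width w"
    "reach w p (0,0) T" "reach w q (0,0) U"
    using grid_reach_origin assms by blast
  then show ?thesis
    using reach_trans[OF _ reach_sym] unfolding diam_def by (intro exI[of _ "T + U"]) auto
qed

lemma closed_grid: "closed G"
  unfolding grid_def aisles_def cross_aisles_def
  by (intro closed_Un closed_UN ballI closed_Times) auto

lemma bounded_grid: "bounded G"
  unfolding grid_def aisles_def cross_aisles_def
  by (intro bounded_Un[THEN iffD2] conjI bounded_UN ballI bounded_Times) auto

lemma sp_dist_le: "reach w p q T \<Longrightarrow> d p q \<le> T"
  unfolding sp_dist_reach by (intro cInf_lower bdd_belowI[of _ 0]) (auto simp: reach_def)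

text \<open>The infimum that defines the distance is attained: curves whose durations approach it are
  uniformly Lipschitz with values in the compact grid, so that by the Arzela-Ascoli theorem a subsequence
  converges. The picker of the model walks along shortest paths, and without their existence there would be
  no optimal plan at all.\<close>
lemma shortest_path:
  assumes "p \<in> G" "q \<in> G" shows "reach w p q (d p q)"
proof -
  define d0 where "d0 = d p q"
  have ne: "{T. reach w p q T} \<noteq> {}" using grid_reach[OF assms] by blast
  have d0: "0 \<le> d0" unfolding d0_def sp_dist_reach using ne by (intro cInf_greatest) (auto simp: reach_def)
  have "\<exists>T. reach w p q T \<and> T < d0 + inverse (real (Suc n))" for n
    using cInf_lessD[OF ne, of "d0 + inverse (real (Suc n))"] by (auto simp: d0_def sp_dist_reach)
  then obtain T where T: "\<And>n. reach w p q (T n)" "\<And>n. T n < d0 + inverse (real (Suc n))" by metis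
  have Tge: "d0 \<le> T n" for n using sp_dist_le[OF T(1)] by (simp add: d0_def)
  obtain \<gamma> where \<gamma>: "\<And>n. lipschitz_on 1 {0..T n} (\<gamma> n)" "\<And>n. \<gamma> n ` {0..T n} \<subseteq> G" "\<And>n. \<gamma> n 0 = p" "\<And>n. \<gamma> n (T n) = q"
    using T(1) unfolding reach_def by metis
  have lip: "dist (\<gamma> n x) (\<gamma> n y) \<le> \<bar>x - y\<bar>" if "x \<in> {0..d0}" "y \<in> {0..d0}" for n x y
    using lipschitz_onD[OF \<gamma>(1), of x n y] that Tge[of n] by (auto simp: dist_real_def)
  have ing: "\<gamma> n x \<in> G" if "x \<in> {0..d0}" for n x
    using \<gamma>(2)[of n] that Tge[of n] by (auto simp: image_subset_iff)
  obtain M where M: "\<And>x. x \<in> G \<Longrightarrow> norm x \<le> M" using bounded_grid by (auto simp: bounded_iff)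
  obtain g k where g: "strict_mono (k :: nat \<Rightarrow> nat)"
    "\<And>e. 0 < e \<Longrightarrow> \<exists>N. \<forall>n x. n \<ge> N \<and> x \<in> {0..d0} \<longrightarrow> norm (\<gamma> (k n) x - g x) < e"
  proof (rule Arzela_Ascoli[of "{0..d0}" \<gamma> M])
    show "\<exists>\<delta>>0. \<forall>n y. y \<in> {0..d0} \<and> norm (x - y) < \<delta> \<longrightarrow> norm (\<gamma> n x - \<gamma> n y) < e"
      if "x \<in> {0..d0}" "0 < e" for x e
    proof (intro exI[of _ e] conjI allI impI)
      fix n y assume y: "y \<in> {0..d0} \<and> norm (x - y) < e"
      show "norm (\<gamma> n x - \<gamma> n y) < e"
        using lip[of x y n] y that by (simp add: dist_norm)
    qed (use that in auto)
  qed (use ing M in auto)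
  \<comment> \<open>the curves are compared on the common part \<open>{0..d0}\<close> of their domains;
    their end points converge because \<open>T n\<close> tends to \<open>d0\<close>\<close>
  have lim: "(\<lambda>n. \<gamma> (k n) x) \<longlonglongrightarrow> g x" if "x \<in> {0..d0}" for x
    unfolding LIMSEQ_iff using g(2) that by blast
  have "lipschitz_on 1 {0..d0} g"
  proof (rule lipschitz_onI)
    fix x y assume xy: "x \<in> {0..d0}" "y \<in> {0..d0}"
    have "(\<lambda>n. dist (\<gamma> (k n) x) (\<gamma> (k n) y)) \<longlonglongrightarrow> dist (g x) (g y)"
      using lim xy by (intro tendsto_dist) auto
    then have "dist (g x) (g y) \<le> \<bar>x - y\<bar>"
      by (rule LIMSEQ_le_const2) (use lip[OF xy] in auto)
    then show "dist (g x) (g y) \<le> 1 * dist x y" by (simp add: dist_real_def)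
  qed simp
  moreover have "g ` {0..d0} \<subseteq> G"
    using closed_sequentially[OF closed_grid, OF _ lim] ing by auto
  moreover have "g 0 = p"
    using lim[of 0] d0 \<gamma>(3) by (auto intro: LIMSEQ_unique)
  moreover have "g d0 = q"
  proof -
    have "(\<lambda>n. \<gamma> (k n) d0) \<longlonglongrightarrow> q"
    proof (rule metric_LIMSEQ_I)
      fix e :: real assume "e > 0"
      then obtain N where N: "inverse (real (Suc N)) < e" using reals_Archimedean by blast
      show "\<exists>N. \<forall>n\<ge>N. dist (\<gamma> (k n) d0) q < e"
      proof (intro exI[of _ N] allI impI)
        fix n assume "n \<ge> N"
        then have "k n \<ge> N" using seq_suble[OF g(1), of n] by linarith
        then have "inverse (real (Suc (k n))) \<le> inverse (real (Suc N))" by (intro le_imp_inverse_le) auto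
        moreover have "dist (\<gamma> (k n) d0) (\<gamma> (k n) (T (k n))) \<le> 1 * dist d0 (T (k n))"
          using Tge[of "k n"] d0 by (intro lipschitz_onD[OF \<gamma>(1)]) auto
        then have "dist (\<gamma> (k n) d0) q \<le> T (k n) - d0"
          using Tge[of "k n"] unfolding \<gamma>(4) dist_real_def by simp
        moreover have "T (k n) - d0 < inverse (real (Suc (k n)))" using T(2)[of "k n"] by linarith
        ultimately show "dist (\<gamma> (k n) d0) q < e"
          using N by (meson le_less_trans less_le_trans less_trans)
      qed
    qed
    with lim[of d0] d0 show ?thesis by (auto intro: LIMSEQ_unique)
  qed
  ultimately show ?thesis unfolding reach_def d0_def[symmetric] using d0 by (auto intro!: exI[of _ g])
qed

lemma d_nonneg: "p \<in> G \<Longrightarrow> q \<in> G \<Longrightarrow> 0 \<le> d p q"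
  using shortest_path by (auto simp: reach_def)

lemma d_refl [simp]: "p \<in> G \<Longrightarrow> d p p = 0"
  using sp_dist_le[OF reach_refl] d_nonneg by (metis order_antisym)

lemma d_sym: "p \<in> G \<Longrightarrow> q \<in> G \<Longrightarrow> d p q = d q p"
  using sp_dist_le[OF reach_sym[OF shortest_path]] by (metis order_antisym)

lemma d_triangle: "p \<in> G \<Longrightarrow> q \<in> G \<Longrightarrow> r \<in> G \<Longrightarrow> d p r \<le> d p q + d q r"
  using sp_dist_le[OF reach_trans[OF shortest_path shortest_path]] by metis

lemma d_le_diam: "p \<in> G \<Longrightarrow> q \<in> G \<Longrightarrow> d p q \<le> diam"
  using grid_reach sp_dist_le by fastforce

lemma diam_nonneg: "0 \<le> diam"
  using W_pos L_nonneg by (simp add: diam_def)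

lemma dist_le_d: "p \<in> G \<Longrightarrow> q \<in> G \<Longrightarrow> dist p q \<le> d p q"
  by (rule dist_le_reach[OF shortest_path])

lemma d_segment: "closed_segment p q \<subseteq> G \<Longrightarrow> d p q \<le> dist p q"
  by (intro sp_dist_le reach_segment)

end

section \<open>Following a sequence of steps\<close>

lemma steps_Nil [simp]: "steps [] = []"
  and steps_Cons [simp]: "steps (b # bs) = map Pick b @ Close # steps bs"
  by (auto simp: steps_def)

lemma steps_append [simp]: "steps (bs @ bs') = steps bs @ steps bs'"
  by (induction bs) auto

lemma Pick_in_steps [simp]: "Pick x \<in> set (steps bs) \<longleftrightarrow> x \<in> set (concat bs)"
  by (induction bs) auto

lemma subseq_steps_filter: "subseq (steps (filter (\<lambda>b. b \<noteq> []) bs)) (steps bs)"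
  by (induction bs) (auto intro: list_emb_append_mono)

lemma subseq_steps_restrict: "subseq (steps (map (filter P) bs)) (steps bs)"
proof (induction bs)
  case (Cons b bs)
  have "subseq (map Pick (filter P b)) (map Pick b)" by (intro subseq_map) auto
  with Cons show ?case by (auto intro!: list_emb_append_mono)
qed simp

lemma subseq_picks: "subseq (map Pick (filter P (concat bs))) (steps bs)"
proof (induction bs)
  case (Cons b bs)
  have "subseq (map Pick (filter P b)) (map Pick b)" by (intro subseq_map) auto
  with Cons show ?case by (auto intro!: list_emb_append_mono)
qed simp

text \<open>The last \<open>Close\<close> is kept while all inner ones are dropped: this turns a whole
  solution, restricted to some items, into a single batch.\<close>
lemma subseq_tour: "bs \<noteq> [] \<Longrightarrow> subseq (map Pick (filter P (concat bs)) @ [Close]) (steps bs)"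
proof (induction bs rule: rev_induct)
  case (snoc b bs)
  have "subseq (map Pick (filter P b) @ [Close]) (map Pick b @ [Close])"
    by (intro list_emb_append_mono subseq_map) auto
  from list_emb_append_mono[OF subseq_picks this] show ?case by simp
qed simp

context warehouse_grid
begin

abbreviation stop :: "system \<Rightarrow> point \<Rightarrow> step list \<Rightarrow> point" where
  "stop sys \<equiv> foldl (dest w sys)"

definition on_grid :: "step list \<Rightarrow> bool" where
  "on_grid es \<longleftrightarrow> (\<forall>x. Pick x \<in> set es \<longrightarrow> snd x \<in> G)"

lemma on_grid_simps [simp]: "on_grid []" "on_grid [Close]" "on_grid (Pick x # es) \<longleftrightarrow> snd x \<in> G \<and> on_grid es"
  "on_grid (Close # es) \<longleftrightarrow> on_grid es" "on_grid (es @ es') \<longleftrightarrow> on_grid es \<and> on_grid es'"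
  by (auto simp: on_grid_def simp del: split_paired_All)

lemma on_grid_picks [simp]: "on_grid (map Pick xs) \<longleftrightarrow> snd ` set xs \<subseteq> G"
  and on_grid_steps [simp]: "on_grid (steps bs) \<longleftrightarrow> snd ` set (concat bs) \<subseteq> G"
  by (auto simp: on_grid_def image_subset_iff simp del: split_paired_All)

lemma on_grid_Cons: "on_grid (e # es) \<Longrightarrow> on_grid [e] \<and> on_grid es"
  by (auto simp: on_grid_def)

lemma on_grid_take: "on_grid es \<Longrightarrow> on_grid (take k es)"
  by (auto simp: on_grid_def dest: in_set_takeD)

lemma dest_grid: "p \<in> G \<Longrightarrow> on_grid [e] \<Longrightarrow> dest w sys p e \<in> G"
  by (cases e) (auto simp: depot_grid)

lemma stop_grid: "p \<in> G \<Longrightarrow> on_grid es \<Longrightarrow> stop sys p es \<in> G"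
proof (induction es arbitrary: p)
  case (Cons e es) then show ?case using dest_grid on_grid_Cons by (metis foldl_Cons)
qed simp

lemma duration_append:
  "duration w sys p (es @ es') = duration w sys p es + duration w sys (stop sys p es) es'"
  by (induction es arbitrary: p) auto

lemma completion_append:
  "completion w sys I p \<tau> (es @ es') =
   completion w sys I (stop sys p es) (completion w sys I p \<tau> es) es'"
  by (induction w sys I p \<tau> es rule: completion.induct) auto

lemma duration_nonneg: "p \<in> G \<Longrightarrow> on_grid es \<Longrightarrow> 0 \<le> duration w sys p es"
proof (induction es arbitrary: p)
  case (Cons e es) 
  then have "dest w sys p e \<in> G" "on_grid es" using dest_grid on_grid_Cons by blast+
  then show ?case using Cons d_nonneg by simp
qed simp

text \<open>Shortest paths between consecutive stops are concatenated. A stop may coincide with the next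
  one, in which case the second path takes over without a jump.\<close>
lemma route_exists: "p \<in> G \<Longrightarrow> on_grid es \<Longrightarrow> \<exists>\<gamma>. route w sys p es \<gamma>"
proof (induction es arbitrary: p)
  case Nil
  then show ?case
    by (intro exI[of _ "\<lambda>_. p"]) (auto simp: route_def intro!: lipschitz_onI)
next
  case (Cons e es)
  define q where "q = dest w sys p e"
  define T where "T = d p q"
  have e: "on_grid [e]" "on_grid es" using on_grid_Cons[OF Cons.prems(2)] by auto
  have q: "q \<in> G" using dest_grid e Cons.prems by (simp add: q_def)
  obtain \<gamma> where T: "0 \<le> T" and \<gamma>: "lipschitz_on 1 {0..T} \<gamma>" "\<gamma> ` {0..T} \<subseteq> G" "\<gamma> 0 = p" "\<gamma> T = q"
    using shortest_path[OF Cons.prems(1) q] by (auto simp: reach_def T_def)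
  obtain \<eta> where \<eta>: "route w sys q es \<eta>" using Cons.IH[OF q e(2)] by blast
  then have \<eta>l: "lipschitz_on 1 {0..} \<eta>" and \<eta>G: "\<eta> ` {0..} \<subseteq> G"
    and \<eta>s: "\<And>k. k \<le> length es \<Longrightarrow> \<eta> (duration w sys q (take k es)) = stop sys q (take k es)"
    and \<eta>e: "\<And>u. u \<ge> duration w sys q es \<Longrightarrow> \<eta> u = stop sys q es"
    by (auto simp: route_def)
  have \<eta>0: "\<eta> 0 = q" using \<eta>s[of 0] by simp
  define \<theta> where "\<theta> u = (if u \<le> T then \<gamma> u else \<eta> (u - T))" for u
  have \<theta>2: "\<theta> u = \<eta> (u - T)" if "u \<ge> T" for u
    using that \<eta>0 \<gamma>(4) by (cases "u = T") (auto simp: \<theta>_def)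
  have "lipschitz_on 1 {0..} \<theta>"
  proof (rule lipschitz_onI)
    fix x y :: real assume xy: "x \<in> {0..}" "y \<in> {0..}"
    have "lipschitz_on 1 {T..T + max x y} (\<lambda>t. \<eta> (t - T))"
    proof (rule lipschitz_onI)
      fix a b assume "a \<in> {T..T + max x y}" "b \<in> {T..T + max x y}"
      then have "dist (\<eta> (a - T)) (\<eta> (b - T)) \<le> 1 * dist (a - T) (b - T)"
        by (intro lipschitz_onD[OF \<eta>l]) auto
      then show "dist (\<eta> (a - T)) (\<eta> (b - T)) \<le> 1 * dist a b"
        by (simp add: dist_real_def)
    qed simp
    then have "lipschitz_on 1 {0..T + max x y} \<theta>"
      unfolding \<theta>_def using \<gamma> \<eta>0 by (intro lipschitz_on_concat) auto
    then show "dist (\<theta> x) (\<theta> y) \<le> 1 * dist x y"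
      by (rule lipschitz_onD) (use T xy in auto)
  qed simp
  moreover have "\<theta> ` {0..} \<subseteq> G"
    using \<gamma>(2) \<eta>G by (auto simp: \<theta>_def image_subset_iff)
  moreover have "\<theta> (duration w sys p (take k (e # es))) = stop sys p (take k (e # es))"
    if "k \<le> length (e # es)" for k
  proof (cases k)
    case 0 then show ?thesis using \<gamma>(3) T by (simp add: \<theta>_def)
  next
    case (Suc k')
    have "0 \<le> duration w sys q (take k' es)" by (intro duration_nonneg q on_grid_take e)
    then show ?thesis using \<eta>s[of k'] that Suc \<theta>2 by (simp add: T_def q_def)
  qed
  moreover have "\<theta> u = stop sys p (e # es)" if "u \<ge> duration w sys p (e # es)" for u
  proof -
    have "0 \<le> duration w sys q es" by (intro duration_nonneg q e)
    then show ?thesis using \<eta>e[of "u - T"] that \<theta>2[of u] by (simp add: T_def q_def)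
  qed
  ultimately show ?case unfolding route_def by blast
qed

lemma route_speed:
  assumes "route w sys p es \<gamma>" "0 \<le> u" "u \<le> v" shows "d (\<gamma> u) (\<gamma> v) \<le> v - u"
proof (rule sp_dist_le)
  have \<gamma>: "lipschitz_on 1 {0..} \<gamma>" "\<gamma> ` {0..} \<subseteq> G" using assms by (auto simp: route_def)
  have "lipschitz_on 1 {0..v-u} (\<lambda>t. \<gamma> (u + t))"
  proof (rule lipschitz_onI)
    fix x y assume "x \<in> {0..v-u}" "y \<in> {0..v-u}"
    then have "dist (\<gamma> (u + x)) (\<gamma> (u + y)) \<le> 1 * dist (u + x) (u + y)"
      using assms by (intro lipschitz_onD[OF \<gamma>(1)]) auto
    then show "dist (\<gamma> (u + x)) (\<gamma> (u + y)) \<le> 1 * dist x y" by (simp add: dist_real_def)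
  qed simp
  then show "reach w (\<gamma> u) (\<gamma> v) (v - u)"
    unfolding reach_def using assms \<gamma>(2)
    by (intro conjI exI[of _ "\<lambda>t. \<gamma> (u + t)"]) (auto simp: image_subset_iff)
qed

lemma route_grid: "route w sys p es \<gamma> \<Longrightarrow> 0 \<le> u \<Longrightarrow> \<gamma> u \<in> G"
  by (auto simp: route_def)

text \<open>Leaving out steps cannot cost more than the way to the start of the longer sequence: by the
  triangle inequality both pickers, following the two sequences, stay within this distance of each other
  until they meet.\<close>
lemma duration_subseq:
  assumes "subseq es es'" "on_grid es'" "p \<in> G" "q \<in> G"
  shows "duration w sys p es \<le> d p q + duration w sys q es'"
  using assms
proof (induction arbitrary: p q rule: list_emb.induct)
  case (list_emb_Nil ys)
  then show ?case using duration_nonneg d_nonneg by simp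
next
  case (list_emb_Cons xs ys y)
  define q' where "q' = dest w sys q y"
  have y: "on_grid [y]" "on_grid ys" using on_grid_Cons list_emb_Cons.prems by auto
  then have q': "q' \<in> G" using dest_grid list_emb_Cons.prems by (simp add: q'_def)
  have "duration w sys p xs \<le> d p q' + duration w sys q' ys"
    using list_emb_Cons y q' by blast
  also have "d p q' \<le> d p q + d q q'" using list_emb_Cons.prems q' by (intro d_triangle)
  finally show ?case by (simp add: q'_def)
next
  case (list_emb_Cons2 x y xs ys)
  have y: "on_grid [y]" "on_grid ys" using on_grid_Cons list_emb_Cons2.prems by auto
  define p' where "p' = dest w sys p y"
  define q' where "q' = dest w sys q y"
  have pq': "p' \<in> G" "q' \<in> G" using dest_grid list_emb_Cons2.prems y by (simp_all add: p'_def q'_def)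
  have "duration w sys p' xs \<le> d p' q' + duration w sys q' ys"
    using list_emb_Cons2 y pq' by blast
  moreover have "d p p' + d p' q' \<le> d p q + d q q'"
  proof (cases "p' = p \<and> q' = q")
    case True then show ?thesis using list_emb_Cons2.prems by simp
  next
    case False
    then have "p' = q'" by (cases y) (auto simp: p'_def q'_def split: if_splits)
    then show ?thesis using d_triangle[of p q q'] list_emb_Cons2.prems pq' by simp
  qed
  ultimately show ?case using list_emb_Cons2(1) by (simp add: p'_def q'_def)
qed

lemma completion_ge:
  "p \<in> G \<Longrightarrow> on_grid es \<Longrightarrow> \<tau> + duration w sys p es \<le> completion w sys I p \<tau> es"
proof (induction es arbitrary: p \<tau>)
  case (Cons e es)
  show ?case
  proof (cases e)
    case (Pick x)
    have "max (\<tau> + d p (snd x)) (fst (I ! fst x)) + duration w sys (snd x) es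
        \<le> completion w sys I p \<tau> (e # es)"
      using Cons.IH[of "snd x"] Cons.prems Pick by simp
    then show ?thesis using Pick by simp
  next
    case Close
    then show ?thesis
      using Cons.IH[of "dest w sys p Close" "\<tau> + d p (dest w sys p Close)"] Cons.prems dest_grid[of p Close]
      by (simp del: dest.simps)
  qed
qed simp

lemma completion_ge_start: "p \<in> G \<Longrightarrow> on_grid es \<Longrightarrow> \<tau> \<le> completion w sys I p \<tau> es"
  using completion_ge[of p es \<tau> sys I] duration_nonneg[of p es sys] by linarith

lemma completion_ge_release:
  "p \<in> G \<Longrightarrow> on_grid es \<Longrightarrow> Pick x \<in> set es \<Longrightarrow> fst (I ! fst x) \<le> completion w sys I p \<tau> es"
proof (induction es arbitrary: p \<tau>)
  case (Cons e es)
  show ?case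
  proof (cases e)
    case (Pick y)
    have "max (\<tau> + d p (snd y)) (fst (I ! fst y)) \<le> completion w sys I p \<tau> (e # es)"
      using completion_ge_start[of "snd y" es] Cons.prems Pick by simp
    moreover have "fst (I ! fst x) \<le> completion w sys I p \<tau> (e # es)" if "Pick x \<in> set es"
      using Cons.IH[of "snd y"] Cons.prems that Pick by simp
    ultimately show ?thesis using Cons.prems Pick by auto
  next
    case Close
    then show ?thesis
      using Cons.IH[of "dest w sys p Close" "\<tau> + d p (dest w sys p Close)"] Cons.prems dest_grid[of p Close]
      by (simp del: dest.simps)
  qed
qed simp

text \<open>The same comparison with waiting times: the picker with fewer steps is always ahead by the time
  that she would need to join the other one.\<close>
lemma completion_subseq:
  assumes "subseq es es'" "on_grid es'" "p \<in> G" "q \<in> G" "\<tau> + d p q \<le> \<tau>'"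
  shows "completion w sys I p \<tau> es \<le> completion w sys I q \<tau>' es'"
  using assms
proof (induction arbitrary: p q \<tau> \<tau>' rule: list_emb.induct)
  case (list_emb_Nil ys)
  then show ?case using completion_ge_start[of q ys \<tau>' sys I] d_nonneg[of p q] by simp
next
  case (list_emb_Cons xs ys y)
  show ?case
  proof (cases y)
    case (Pick x)
    show ?thesis unfolding Pick completion.simps
      using list_emb_Cons Pick d_triangle[of p q "snd x"]
      by (intro list_emb_Cons.IH) auto
  next
    case Close
    have q': "dest w sys q Close \<in> G" using depot_grid list_emb_Cons.prems by simp
    show ?thesis unfolding Close completion.simps
      using list_emb_Cons Close d_triangle[of p q "dest w sys q Close"] q'
      by (intro list_emb_Cons.IH) (auto simp del: dest.simps)
  qed
next
  case (list_emb_Cons2 x y xs ys)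
  show ?case
  proof (cases y)
    case (Pick z)
    have "\<tau> + d p (snd z) \<le> \<tau>' + d q (snd z)"
      using list_emb_Cons2.prems Pick d_triangle[of p q "snd z"] by simp
    then show ?thesis using list_emb_Cons2 Pick by (auto intro!: list_emb_Cons2.IH)
  next
    case Close
    have "\<tau> + d p (depot w) \<le> \<tau>' + d q (depot w)"
      using list_emb_Cons2.prems Close d_triangle[of p q "depot w"] depot_grid by simp
    then show ?thesis using list_emb_Cons2 Close depot_grid by (auto intro!: list_emb_Cons2.IH)
  qed
qed

text \<open>Once all orders involved have been released, no waiting occurs. The distance from
  \<open>e\<close> to \<open>p\<close> matters when a plan is interrupted between two stops: the stop
  \<open>e\<close> was the last one reached by time \<open>\<tau>\<close>, whereas the picker has moved on
  to \<open>p\<close> by time \<open>\<sigma>\<close>.\<close>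
lemma completion_released:
  assumes "on_grid es" "e \<in> G" "p \<in> G" "\<tau> + d e p \<le> \<sigma>"
    and "\<And>x. Pick x \<in> set es \<Longrightarrow> fst (I ! fst x) \<le> \<sigma>"
  shows "completion w sys I e \<tau> es + d (stop sys e es) (stop sys p es) \<le> \<sigma> + duration w sys p es"
  using assms
proof (induction es arbitrary: e p \<tau> \<sigma>)
  case (Cons a es)
  show ?case
  proof (cases a)
    case (Pick x)
    have q: "snd x \<in> G" using Cons.prems Pick by simp
    have "fst (I ! fst x) \<le> \<sigma>" using Cons.prems Pick by simp
    moreover have "\<tau> + d e (snd x) \<le> \<sigma> + d p (snd x)"
      using d_triangle[of e p "snd x"] Cons.prems q by simp
    moreover have "0 \<le> d p (snd x)" using d_nonneg Cons.prems q by simp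
    moreover from this have rel: "fst (I ! fst z) \<le> \<sigma> + d p (snd x)" if "Pick z \<in> set es" for z
      using Cons.prems(5)[of z] that by simp
    ultimately have
      "completion w sys I (snd x) (max (\<tau> + d e (snd x)) (fst (I ! fst x))) es
         + d (stop sys (snd x) es) (stop sys (snd x) es)
       \<le> \<sigma> + d p (snd x) + duration w sys (snd x) es"
      using Cons.prems(1-4) Pick q rel by (intro Cons.IH) auto
    then show ?thesis using Pick by simp
  next
    case Close
    show ?thesis
    proof (cases "sys = Robot")
      case True
      then show ?thesis using Close Cons.prems Cons.IH[of e p \<tau> \<sigma>] by simp
    next
      case False
      have "\<tau> + d e (depot w) \<le> \<sigma> + d p (depot w)"
        using d_triangle[of e p "depot w"] Cons.prems depot_grid by simp
      moreover have "0 \<le> d p (depot w)" using d_nonneg Cons.prems depot_grid by simp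
      moreover from this have rel: "fst (I ! fst z) \<le> \<sigma> + d p (depot w)" if "Pick z \<in> set es" for z
        using Cons.prems(5)[of z] that by simp
      ultimately have "completion w sys I (depot w) (\<tau> + d e (depot w)) es
         + d (stop sys (depot w) es) (stop sys (depot w) es)
       \<le> \<sigma> + d p (depot w) + duration w sys (depot w) es"
        using Cons.prems(1-4) Close depot_grid rel by (intro Cons.IH) auto
      then show ?thesis using Close False by simp
    qed
  qed
qed simp

text \<open>Lower bounds on the travel time are stated with the Euclidean distance, which is symmetric
  without any reference to the grid and measurable as a function of the locations.\<close>
lemma dist_le_duration_pick:
  "p \<in> G \<Longrightarrow> on_grid es \<Longrightarrow> Pick x \<in> set es \<Longrightarrow> dist p (snd x) \<le> duration w sys p es"
proof (induction es arbitrary: p)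
  case (Cons e es)
  define q where "q = dest w sys p e"
  have e: "on_grid [e]" "on_grid es" using on_grid_Cons Cons.prems by auto
  then have q: "q \<in> G" using dest_grid Cons.prems by (simp add: q_def)
  have "dist p q \<le> d p q" using dist_le_d Cons.prems q by simp
  moreover have "dist q (snd x) \<le> duration w sys q es"
  proof (cases "Pick x \<in> set es")
    case True then show ?thesis using Cons.IH q e by simp
  next
    case False
    then have "q = snd x" using Cons.prems by (auto simp: q_def)
    then show ?thesis using duration_nonneg q e by simp
  qed
  ultimately show ?case using dist_triangle[of p "snd x" q] by (simp add: q_def)
qed simp

lemma dist_le_duration_close:
  "p \<in> G \<Longrightarrow> on_grid es \<Longrightarrow> sys \<noteq> Robot \<Longrightarrow> dist p (depot w) \<le> duration w sys p (es @ [Close])"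
proof (induction es arbitrary: p)
  case Nil then show ?case using dist_le_d depot_grid by simp
next
  case (Cons e es)
  define q where "q = dest w sys p e"
  have e: "on_grid [e]" "on_grid es" using on_grid_Cons Cons.prems by auto
  then have q: "q \<in> G" using dest_grid Cons.prems by (simp add: q_def)
  have "dist p q \<le> d p q" using dist_le_d Cons.prems q by simp
  moreover have "dist q (depot w) \<le> duration w sys q (es @ [Close])" using Cons e q by simp
  ultimately show ?case using dist_triangle[of p "depot w" q] by (simp add: q_def)
qed

lemma dist_le_duration_picks:
  "p \<in> G \<Longrightarrow> on_grid es \<Longrightarrow> Pick x \<in> set es \<Longrightarrow> Pick y \<in> set es \<Longrightarrow>
    dist (snd x) (snd y) \<le> duration w sys p es"
proof (induction es arbitrary: p)
  case (Cons e es)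
  define q where "q = dest w sys p e"
  have e: "on_grid [e]" "on_grid es" using on_grid_Cons Cons.prems by auto
  then have q: "q \<in> G" using dest_grid Cons.prems by (simp add: q_def)
  have "dist (snd x) (snd y) \<le> duration w sys q es"
  proof (cases "Pick x \<in> set es \<and> Pick y \<in> set es")
    case True then show ?thesis using Cons.IH q e by simp
  next
    case False
    then consider "x = y" | "e = Pick x" "Pick y \<in> set es" | "e = Pick y" "Pick x \<in> set es"
      using Cons.prems by auto
    then show ?thesis
      using dist_le_duration_pick[OF q e(2), of x sys] dist_le_duration_pick[OF q e(2), of y sys]
        duration_nonneg[OF q e(2), of sys]
      by cases (simp_all add: q_def dist_commute)
  qed
  then show ?case using d_nonneg[of p q] Cons.prems q by (simp add: q_def)
qed simp

lemma dist_le_duration_depot: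
  "p \<in> G \<Longrightarrow> on_grid es \<Longrightarrow> sys \<noteq> Robot \<Longrightarrow> Pick x \<in> set es \<Longrightarrow>
    dist (depot w) (snd x) \<le> duration w sys p (es @ [Close])"
proof (induction es arbitrary: p)
  case (Cons e es)
  define q where "q = dest w sys p e"
  have e: "on_grid [e]" "on_grid es" using on_grid_Cons Cons.prems by auto
  then have q: "q \<in> G" using dest_grid Cons.prems by (simp add: q_def)
  have "dist (depot w) (snd x) \<le> duration w sys q (es @ [Close])"
  proof (cases "Pick x \<in> set es")
    case True then show ?thesis using Cons q e by simp
  next
    case False
    then have "q = snd x" using Cons.prems by (auto simp: q_def)
    then show ?thesis using dist_le_duration_close[OF q e(2)] Cons.prems by (simp add: dist_commute)
  qed
  then show ?case using d_nonneg[of p q] Cons.prems q by (simp add: q_def)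
qed simp


section \<open>Tours through the warehouse\<close>

definition aisle :: "nat \<Rightarrow> point set" where
  "aisle i = {real i * wh_length w / real (wh_aisles w - 1)} \<times> {0..wh_width w}"

lemma aisle_grid: "i < wh_aisles w \<Longrightarrow> aisle i \<subseteq> G"
  by (auto simp: aisle_def grid_def aisles_def)

lemma sweep_aisle:
  assumes "i < wh_aisles w" "p \<in> aisle i" "snd ` set xs \<subseteq> aisle i"
    and "sorted (snd p # map (snd \<circ> snd) xs)"
  shows "duration w sys p (map Pick xs) \<le> wh_width w - snd p"
  using assms
proof (induction xs arbitrary: p)
  case Nil then show ?case by (auto simp: aisle_def)
next
  case (Cons x xs)
  have "convex (aisle i)" by (auto simp: aisle_def intro: convex_Times)
  then have "closed_segment p (snd x) \<subseteq> aisle i" using Cons.prems by (intro closed_segment_subset) auto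
  then have "d p (snd x) \<le> dist p (snd x)" using aisle_grid Cons.prems by (intro d_segment) blast
  also have "dist p (snd x) = snd (snd x) - snd p"
    using Cons.prems by (cases p; cases x) (auto simp: aisle_def dist_Pair_Pair dist_real_def)
  finally show ?case using Cons.IH[of "snd x"] Cons.prems by auto
qed

text \<open>Any number of items can be collected in bounded time: within each aisle they are visited by
  increasing height, and the aisles one after the other. The number of locations in an order is not bounded,
  hence a bound per item would not do.\<close>
lemma tour_aisles:
  assumes "n \<le> wh_aisles w" "finite Q" "snd ` Q \<subseteq> (\<Union>i<n. aisle i)"
  shows "\<exists>xs. distinct xs \<and> set xs = Q \<and>
    (\<forall>p\<in>G. duration w sys p (map Pick xs) \<le> real n * (diam + wh_width w))"
  using assms
proof (induction n arbitrary: Q)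
  case 0 then show ?case by auto
next
  case (Suc n)
  define Q1 where "Q1 = {x \<in> Q. snd x \<in> aisle n}"
  have rest: "snd ` (Q - Q1) \<subseteq> (\<Union>i<n. aisle i)"
    using Suc.prems(3) by (force simp: Q1_def less_Suc_eq)
  then obtain xs where xs: "distinct xs" "set xs = Q - Q1"
    "\<And>p. p \<in> G \<Longrightarrow> duration w sys p (map Pick xs) \<le> real n * (diam + wh_width w)"
    using Suc.IH[of "Q - Q1"] Suc.prems by auto
  obtain zs where zs: "set zs = Q1" "distinct zs"
    using finite_distinct_list[of Q1] Suc.prems by (auto simp: Q1_def)
  \<comment> \<open>the items of the last aisle, from bottom to top\<close>
  define ys where "ys = sort_key (snd \<circ> snd) zs"
  have ys: "set ys = Q1" "distinct ys" "sorted (map (snd \<circ> snd) ys)"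
    using zs by (auto simp: ys_def)
  have Gn: "aisle n \<subseteq> G" using aisle_grid Suc.prems by simp
  have dy: "duration w sys p (map Pick ys) \<le> diam + wh_width w" if p: "p \<in> G" for p
  proof (cases ys)
    case Nil then show ?thesis using diam_nonneg W_pos by simp
  next
    case (Cons y ys')
    then have y: "snd ` set ys \<subseteq> aisle n" using ys(1) by (auto simp: Q1_def)
    then have yn: "snd y \<in> aisle n" using Cons by simp
    have "duration w sys (snd y) (map Pick ys') \<le> wh_width w - snd (snd y)"
      using ys(3) Cons y yn Suc.prems by (intro sweep_aisle[of n]) auto
    moreover have "0 \<le> snd (snd y)" using yn by (auto simp: aisle_def)
    moreover have "d p (snd y) \<le> diam" using d_le_diam p yn Gn by blast
    ultimately show ?thesis using Cons by simp
  qed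
  show ?case
  proof (intro exI[of _ "xs @ ys"] conjI ballI)
    show "set (xs @ ys) = Q" using xs ys by (auto simp: Q1_def)
    show "distinct (xs @ ys)" using xs ys by auto
    fix p assume p: "p \<in> G"
    have "aisle i \<subseteq> G" if "i < n" for i using aisle_grid that Suc.prems(1) by simp
    then have "(\<Union>i<n. aisle i) \<subseteq> G" by (rule UN_least) simp
    with rest have "on_grid (map Pick xs)" unfolding on_grid_picks xs(2) by (rule order_trans)
    then have "stop sys p (map Pick xs) \<in> G" by (rule stop_grid[OF p])
    from dy[OF this] xs(3)[OF p]
    have "duration w sys p (map Pick xs) + duration w sys (stop sys p (map Pick xs)) (map Pick ys)
      \<le> real n * (diam + wh_width w) + (diam + wh_width w)" by (rule add_mono[rotated])
    then show "duration w sys p (map Pick (xs @ ys)) \<le> real (Suc n) * (diam + wh_width w)"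
      by (simp add: duration_append algebra_simps)
  qed
qed

definition tour_const :: real where
  "tour_const = real (wh_aisles w) * (diam + wh_width w) + diam"

lemma tour_const_nonneg: "0 \<le> tour_const"
  using diam_nonneg W_pos by (simp add: tour_const_def)

text \<open>A common bound for the cost of collecting any of these items in one batch. It is used with a
  constant of the warehouse, with the optimal value of the instance, and with zero if everything is at the
  depot.\<close>
definition tourable :: "system \<Rightarrow> item set \<Rightarrow> real \<Rightarrow> bool" where
  "tourable sys A B \<longleftrightarrow> (\<forall>Q\<subseteq>A. \<exists>xs. distinct xs \<and> set xs = Q \<and>
     duration w sys (depot w) (map Pick xs @ [Close]) \<le> B)"

lemma tourable_const:
  assumes "finite A" "snd ` A \<subseteq> aisles w" shows "tourable sys A tour_const"
  unfolding tourable_def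
proof (intro allI impI)
  fix Q assume Q: "Q \<subseteq> A"
  have fin: "finite Q" using Q assms(1) by (rule finite_subset)
  have sub: "snd ` Q \<subseteq> aisles w" using Q assms(2) by blast
  have al: "aisles w = (\<Union>i<wh_aisles w. aisle i)" by (simp add: aisles_def aisle_def)
  obtain xs where xs: "distinct xs \<and> set xs = Q \<and>
    (\<forall>p\<in>G. duration w sys p (map Pick xs) \<le> real (wh_aisles w) * (diam + wh_width w))"
    using tour_aisles[OF order_refl fin sub[unfolded al]] ..
  have "on_grid (map Pick xs)" using xs sub aisles_grid by auto
  then have p: "stop sys (depot w) (map Pick xs) \<in> G" (is "?p \<in> G") by (rule stop_grid[OF depot_grid])
  then have "d ?p (dest w sys ?p Close) \<le> diam"
    by (intro d_le_diam dest_grid on_grid_simps)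
  moreover have "duration w sys (depot w) (map Pick xs) \<le> real (wh_aisles w) * (diam + wh_width w)"
    using xs depot_grid by blast
  ultimately have "duration w sys (depot w) (map Pick xs @ [Close]) \<le> tour_const"
    by (simp add: duration_append tour_const_def del: dest.simps)
  with xs show "\<exists>xs. distinct xs \<and> set xs = Q \<and>
     duration w sys (depot w) (map Pick xs @ [Close]) \<le> tour_const" by (intro exI[of _ xs] conjI) auto
qed

end

section \<open>Batchings and partially executed plans\<close>

abbreviation unsplit :: "item list list \<Rightarrow> bool" where
  "unsplit \<equiv> sorted_wrt (\<lambda>b b'. orders_of b \<inter> orders_of b' = {})"

lemma orders_of_simps [simp]: "orders_of [] = {}" "orders_of (x # b) = insert (fst x) (orders_of b)"
  "orders_of (b @ b') = orders_of b \<union> orders_of b'"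
  by (auto simp: orders_of_def)

lemma finite_orders_of [simp]: "finite (orders_of b)"
  by (simp add: orders_of_def)

lemma orders_of_filter: "orders_of (filter P b) \<subseteq> orders_of b"
  by (auto simp: orders_of_def)

lemma finite_items [simp]: "finite (items I)"
proof -
  have "items I \<subseteq> (\<Union>j<length I. {j} \<times> set (snd (I ! j)))" by (auto simp: items_def)
  then show ?thesis by (rule finite_subset) auto
qed

lemma items_take: "items (take m I) = {x \<in> items I. fst x < m}"
  by (auto simp: items_def)

text \<open>Finiteness is needed twice: the minimum over all solutions is attained, and so is the minimum
  over all feasible plans.\<close>
lemma finite_batchings:
  assumes "finite A"
  shows "finite {bs. distinct (concat bs) \<and> set (concat bs) = A \<and> [] \<notin> set bs}"
proof -
  define B where "B = {b. set b \<subseteq> A \<and> distinct b}"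
  have "finite B" using assms by (simp add: B_def finite_subset_distinct)
  then have "finite {bs. set bs \<subseteq> B \<and> distinct bs}" by (rule finite_subset_distinct)
  then show ?thesis
    by (rule finite_subset[rotated]) (auto simp: B_def distinct_concat_iff)
qed

lemma unsplit_restrict:
  assumes "unsplit bs" shows "unsplit (filter Q (map (filter P) bs))"
  unfolding sorted_wrt_map
  by (rule sorted_wrt_filter, unfold sorted_wrt_map, rule sorted_wrt_mono_rel[OF _ assms])
     (use orders_of_filter in blast)

lemma restrict_batches:
  fixes P
  defines "cs \<equiv> \<lambda>bs. filter (\<lambda>b. b \<noteq> []) (map (filter P) bs)"
  shows "set (concat (cs bs)) = {x \<in> set (concat bs). P x}"
    and "distinct (concat bs) \<Longrightarrow> distinct (concat (cs bs))"
    and "b \<in> set (cs bs) \<Longrightarrow> b \<noteq> [] \<and> (\<exists>b0\<in>set bs. b = filter P b0)"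
proof -
  have 1: "concat (cs bs) = filter P (concat bs)" for bs
    unfolding cs_def by (induction bs) auto
  show "set (concat (cs bs)) = {x \<in> set (concat bs). P x}" by (simp add: 1)
  show "distinct (concat bs) \<Longrightarrow> distinct (concat (cs bs))" by (simp add: 1)
  show "b \<in> set (cs bs) \<Longrightarrow> b \<noteq> [] \<and> (\<exists>b0\<in>set bs. b = filter P b0)" by (auto simp: cs_def)
qed

context warehouse_grid
begin

text \<open>A solution in which empty batches are tolerated. A remainder of the current batch may be empty,
  and the steps of an online run are then described without case distinctions.\<close>
definition partition :: "inst \<Rightarrow> item list list \<Rightarrow> bool" where
  "partition K bs \<longleftrightarrow> batching (items K) bs \<and> (\<forall>b\<in>set bs. card (orders_of b) \<le> capacity w)"

text \<open>The part of a solution that has been carried out: the finished batches \<open>fb\<close>, the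
  items \<open>cb\<close> in the cart, and the unpicked items \<open>Q\<close> of the revealed instance
  \<open>K\<close>. Orders of finished batches have no unpicked items, and so every feasible continuation
  completes a partition.\<close>
definition progress :: "inst \<Rightarrow> item set \<Rightarrow> nat set \<Rightarrow> item list list \<Rightarrow> item list \<Rightarrow> bool" where
  "progress K Q C fb cb \<longleftrightarrow>
     distinct (concat fb @ cb) \<and> set (concat fb @ cb) \<union> Q = items K \<and>
     set (concat fb @ cb) \<inter> Q = {} \<and> unsplit (fb @ [cb]) \<and>
     orders_of (concat fb) \<inter> fst ` Q = {} \<and>
     (\<forall>b\<in>set (fb @ [cb]). card (orders_of b) \<le> capacity w) \<and> C = orders_of cb"

lemma solution_partition:
  assumes "partition K bs" shows "solution w K (filter (\<lambda>b. b \<noteq> []) bs)"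
proof -
  have "concat (filter (\<lambda>b. b \<noteq> []) bs) = concat bs" by (induction bs) auto
  then show ?thesis
    using assms by (auto simp: partition_def solution_def batching_def intro: sorted_wrt_filter)
qed

lemma partition_progress:
  assumes "partition K (fb @ (cb @ b) # bs)"
  shows "progress K (set b \<union> set (concat bs)) (orders_of cb) fb cb"
proof -
  have "card (orders_of cb) \<le> card (orders_of (cb @ b))" by (intro card_mono) auto
  then have "card (orders_of cb) \<le> capacity w" using assms by (auto simp: partition_def)
  moreover have "orders_of (concat fb) \<inter> fst ` (set b \<union> set (concat bs)) = {}"
  proof -
    have "orders_of b1 \<inter> orders_of b2 = {}" if "b1 \<in> set fb" "b2 \<in> set ((cb @ b) # bs)" for b1 b2
      using assms that unfolding partition_def batching_def sorted_wrt_append by blast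
    then have "orders_of b1 \<inter> (\<Union>b2\<in>set ((cb @ b) # bs). orders_of b2) = {}" if "b1 \<in> set fb" for b1
      using that by blast
    moreover have "orders_of (concat fb) = (\<Union>b1\<in>set fb. orders_of b1)" by (auto simp: orders_of_def)
    ultimately have "orders_of (concat fb) \<inter> (\<Union>b2\<in>set ((cb @ b) # bs). orders_of b2) = {}" by blast
    moreover have "fst ` (set b \<union> set (concat bs)) \<subseteq> (\<Union>b2\<in>set ((cb @ b) # bs). orders_of b2)"
      by (auto simp: orders_of_def)
    ultimately show ?thesis by blast
  qed
  moreover have "unsplit (fb @ [cb])"
    using assms by (auto simp: partition_def batching_def sorted_wrt_append)
  ultimately show ?thesis
    using assms unfolding progress_def partition_def batching_def by simp blast
qed

lemma progress_partition:
  assumes "progress (known s) (pending s) (cart s) fb cb" "feasible w s bs"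
  shows "partition (known s) (fb @ (cb @ hd bs) # tl bs)"
proof -
  have bs: "bs \<noteq> []" "distinct (concat bs)" "set (concat bs) = pending s" "unsplit bs"
    "card (orders_of cb \<union> orders_of (hd bs)) \<le> capacity w"
    "\<And>b. b \<in> set (tl bs) \<Longrightarrow> orders_of b \<inter> orders_of cb = {} \<and> card (orders_of b) \<le> capacity w"
    using assms by (auto simp: feasible_def batching_def progress_def)
  obtain b bs' where eq: "bs = b # bs'" using bs(1) by (cases bs) auto
  have o: "orders_of (concat fb) = (\<Union>b\<in>set fb. orders_of b)" by (auto simp: orders_of_def)
  have p: "fst ` pending s = orders_of b \<union> (\<Union>b\<in>set bs'. orders_of b)"
    unfolding bs(3)[symmetric] eq by (auto simp: orders_of_def)
  show ?thesis
    using assms(1) bs unfolding progress_def partition_def batching_def o p eq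
    by (auto simp: sorted_wrt_append)
qed

lemma partition_append_Nil: "partition K bs \<Longrightarrow> partition K (bs @ [[]])"
  by (auto simp: partition_def batching_def sorted_wrt_append)

text \<open>New orders have new indices, hence they are disjoint from all that has been picked.\<close>
lemma progress_reveal:
  assumes "progress (take m I) Q C fb cb" "m \<le> m'"
  shows "progress (take m' I) (Q \<union> {x \<in> items (take m' I). length (take m I) \<le> fst x}) C fb cb"
proof -
  define N where "N = {x \<in> items (take m' I). length (take m I) \<le> fst x}"
  have old: "fst x < length (take m I)" if "x \<in> items (take m I)" for x
    using that by (auto simp: items_def)
  have new: "items (take m' I) = items (take m I) \<union> N"
    using assms(2) by (auto simp: N_def items_take)
  have sub: "set (concat fb @ cb) \<subseteq> items (take m I)"
    using assms by (auto simp: progress_def)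
  then have 1: "set (concat fb @ cb) \<inter> N = {}" using old by (fastforce simp: N_def)
  have "fst ` N \<inter> fst ` set (concat fb) = {}" using old sub by (fastforce simp: N_def)
  then have 2: "orders_of (concat fb) \<inter> fst ` N = {}" by (auto simp: orders_of_def)
  show ?thesis
    unfolding N_def[symmetric] using assms(1) 1 2 unfolding progress_def new by (simp add: image_Un Int_Un_distrib) blast
qed

text \<open>Following a plan for some time moves a marker through the fixed list of batches \<open>fb @ (cb
  @ hd bs) # tl bs\<close>: a pick moves one item across it, a \<open>Close\<close> one batch. So the list
  remains a partition, and what has been done is a prefix of its steps.\<close>
lemma advance_progress:
  assumes "bs \<noteq> []" "partition K (fb @ (cb @ hd bs) # tl bs)" "0 \<le> u"
    and "advance w sys u p (steps bs) (orders_of cb) (set (concat bs)) = (C, Q)"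
  shows "\<exists>fb' cb' k. progress K Q C fb' cb' \<and> k \<le> length (steps bs) \<and>
     steps fb' @ map Pick cb' = steps fb @ map Pick cb @ take k (steps bs) \<and>
     duration w sys p (take k (steps bs)) \<le> u"
  using assms
proof (induction "length (steps bs)" arbitrary: bs fb cb u p rule: less_induct)
  case less
  obtain b bs' where bs: "bs = b # bs'" using less.prems(1) by (cases bs) auto
  have P: "progress K (set (concat bs)) (orders_of cb) fb cb"
    using partition_progress[of K fb cb b bs'] less.prems(2) bs by simp
  have stay: ?case if "C = orders_of cb" "Q = set (concat bs)"
    using P that less.prems(3) by (intro exI[of _ fb] exI[of _ cb] exI[of _ 0]) auto
  show ?case
  proof (cases b)
    case Nil
    define q where "q = dest w sys p Close"
    show ?thesis
    proof (cases "d p q \<le> u")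
      case False
      then show ?thesis using less.prems(4) stay by (auto simp: bs Nil q_def Let_def split: if_splits)
    next
      case True
      have adv: "advance w sys (u - d p q) q (steps bs') {} (set (concat bs')) = (C, Q)"
        using less.prems(4) True by (simp add: bs Nil q_def Let_def split: if_splits)
      have part: "partition K ((fb @ [cb]) @ bs')" using less.prems(2) by (simp add: bs Nil)
      show ?thesis
      proof (cases "bs' = []")
        case True': True
        \<comment> \<open>the last batch has just been closed; an empty batch takes the role of the current
          one\<close>
        have "progress K {} {} (fb @ [cb]) []"
          using partition_progress[of K "fb @ [cb]" "[]" "[]" "[]"] partition_append_Nil[OF part] True' by simp
        then show ?thesis
          using adv True True' by (intro exI[of _ "fb @ [cb]"] exI[of _ "[]"] exI[of _ 1])
            (auto simp: bs Nil q_def simp del: dest.simps)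
      next
        case False
        have "partition K ((fb @ [cb]) @ ([] @ hd bs') # tl bs')" using part False by simp
        moreover have "length (steps bs') < length (steps bs)" by (simp add: bs)
        ultimately obtain fb' cb' k where "progress K Q C fb' cb'" "k \<le> length (steps bs')"
          "steps fb' @ map Pick cb' = steps (fb @ [cb]) @ map Pick [] @ take k (steps bs')"
          "duration w sys q (take k (steps bs')) \<le> u - d p q"
          using less.hyps[of bs' "fb @ [cb]" "[]" "u - d p q" q] adv False True by auto
        then show ?thesis
          by (intro exI[of _ fb'] exI[of _ cb'] exI[of _ "Suc k"]) (auto simp: bs Nil q_def simp del: dest.simps)
      qed
    qed
  next
    case (Cons x b')
    show ?thesis
    proof (cases "d p (snd x) \<le> u")
      case False
      then show ?thesis using less.prems(4) stay by (auto simp: bs Cons)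
    next
      case True
      have "distinct (x # b' @ concat bs')"
        using less.prems(2) by (simp add: bs Cons partition_def batching_def)
      then have Q: "set (concat bs) - {x} = set (concat (b' # bs'))" by (auto simp: bs Cons)
      have adv: "advance w sys (u - d p (snd x)) (snd x) (steps (b' # bs')) (orders_of (cb @ [x])) (set (concat (b' # bs'))) = (C, Q)"
        using less.prems(4) True unfolding Q[symmetric] by (simp add: bs Cons)
      have "partition K (fb @ ((cb @ [x]) @ hd (b' # bs')) # tl (b' # bs'))"
        using less.prems(2) by (simp add: bs Cons)
      moreover have "length (steps (b' # bs')) < length (steps bs)" by (simp add: bs Cons)
      ultimately obtain fb' cb' k where "progress K Q C fb' cb'" "k \<le> length (steps (b' # bs'))"
        "steps fb' @ map Pick cb' = steps fb @ map Pick (cb @ [x]) @ take k (steps (b' # bs'))"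
        "duration w sys (snd x) (take k (steps (b' # bs'))) \<le> u - d p (snd x)"
        using less.hyps[OF _ _ _ _ adv, of fb] True by auto
      then show ?thesis
        by (intro exI[of _ fb'] exI[of _ cb'] exI[of _ "Suc k"]) (auto simp: bs Cons)
    qed
  qed
qed

lemma stop_steps: "sys \<noteq> Robot \<Longrightarrow> bs \<noteq> [] \<Longrightarrow> stop sys p (steps bs) = depot w"
  by (induction bs rule: rev_induct) auto

lemma stop_steps_depot: "sys \<noteq> Robot \<Longrightarrow> stop sys (depot w) (steps bs) = depot w"
  using stop_steps by (cases "bs = []") auto

lemma serve_prefix:
  assumes "serve w \<tau> bs r = (\<tau>', bs')"
  shows "\<exists>dn. bs = dn @ bs' \<and> r \<le> \<tau>' \<and>
     \<tau> + duration w PcartN (depot w) (steps dn) \<le> \<tau>'"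
  using assms
proof (induction bs arbitrary: \<tau>)
  case (Cons b bs)
  show ?case
  proof (cases "r \<le> \<tau>")
    case True then show ?thesis using Cons.prems by auto
  next
    case False
    then have "serve w (\<tau> + duration w PcartN (depot w) (steps [b])) bs r = (\<tau>', bs')"
      using Cons.prems by simp
    from Cons.IH[OF this] obtain dn where "bs = dn @ bs'" "r \<le> \<tau>'"
      "\<tau> + duration w PcartN (depot w) (steps [b]) + duration w PcartN (depot w) (steps dn) \<le> \<tau>'"
      by blast
    moreover have "duration w PcartN (depot w) (steps (b # dn)) =
      duration w PcartN (depot w) (steps [b]) + duration w PcartN (depot w) (steps dn)"
      using duration_append[of PcartN "depot w" "steps [b]" "steps dn"] by simp
    ultimately show ?thesis by (intro exI[of _ "b # dn"]) simp
  qed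
qed auto

text \<open>The batch that is in progress when an order arrives started before the arrival, so it ends at
  most one batch later.\<close>
lemma serve_clock:
  assumes "serve w \<tau> bs r = (\<tau>', bs')" "0 \<le> B" "\<tau> \<le> r + B"
    and "\<And>b. b \<in> set bs \<Longrightarrow> duration w PcartN (depot w) (steps [b]) \<le> B"
  shows "\<tau>' \<le> r + B"
  using assms
proof (induction bs arbitrary: \<tau>)
  case (Cons b bs)
  show ?case
  proof (cases "r \<le> \<tau>")
    case True then show ?thesis using Cons.prems by auto
  next
    case False
    show ?thesis
    proof (rule Cons.IH)
      show "serve w (\<tau> + duration w PcartN (depot w) (steps [b])) bs r = (\<tau>', bs')"
        using Cons.prems(1) False by simp
      show "\<tau> + duration w PcartN (depot w) (steps [b]) \<le> r + B"
        using Cons.prems(4)[of b] False by simp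
    qed (use Cons.prems in auto)
  qed
qed auto

lemma d_stop_le_duration:
  "p \<in> G \<Longrightarrow> on_grid es \<Longrightarrow> d p (stop sys p es) \<le> duration w sys p es"
proof (induction es arbitrary: p)
  case (Cons e es)
  define q where "q = dest w sys p e"
  have e: "on_grid [e]" "on_grid es" using on_grid_Cons Cons.prems by auto
  then have q: "q \<in> G" using dest_grid Cons.prems by (simp add: q_def)
  have "d p (stop sys q es) \<le> d p q + d q (stop sys q es)"
    by (rule d_triangle[OF Cons.prems(1) q stop_grid[OF q e(2)]])
  also have "\<dots> \<le> d p q + duration w sys q es" using Cons.IH[OF q e(2)] by simp
  finally show ?case by (simp add: q_def)
qed simp

lemma duration_at_depot:
  assumes "sys \<noteq> Robot" "\<And>x. Pick x \<in> set es \<Longrightarrow> snd x = depot w"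
  shows "duration w sys (depot w) es = 0"
  using assms(2)
proof (induction es)
  case (Cons e es)
  have "dest w sys (depot w) e = depot w" using assms(1) Cons.prems[of "case e of Pick x \<Rightarrow> x"] by (cases e) simp_all
  moreover have "duration w sys (depot w) es = 0" using Cons.prems by (intro Cons.IH) simp
  ultimately show ?case using depot_grid by simp
qed simp

lemma stop_at_depot:
  assumes "sys \<noteq> Robot" "\<And>x. Pick x \<in> set es \<Longrightarrow> snd x = depot w"
  shows "stop sys (depot w) es = depot w"
  using assms(2)
proof (induction es)
  case (Cons e es)
  have "dest w sys (depot w) e = depot w" using assms(1) Cons.prems[of "case e of Pick x \<Rightarrow> x"] by (cases e) simp_all
  moreover have "stop sys (depot w) es = depot w" using Cons.prems by (intro Cons.IH) simp
  ultimately show ?case by simp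
qed simp

end

section \<open>Optimal plans and optimal solutions\<close>

locale order_instance = warehouse_grid +
  fixes sys :: system and sel :: "situation \<Rightarrow> plan" and I :: inst
  assumes tie: "tie_breaking w sys sel"
    and sorted: "sorted (map fst I)"
    and times_nonneg: "\<And>x. x \<in> set I \<Longrightarrow> 0 \<le> fst x"
    and valid_orders: "\<And>x. x \<in> set I \<Longrightarrow> valid_order w (snd x)"
begin

lemma items_aisles: "snd ` items I \<subseteq> aisles w"
proof -
  have "snd x \<in> aisles w" if "x \<in> items I" for x
    using that valid_orders[of "I ! fst x"] by (auto simp: items_def valid_order_def)
  then show ?thesis by blast
qed

lemma items_grid: "snd ` items I \<subseteq> G"
  using items_aisles aisles_grid by blast

text \<open>One batch per order.\<close>
lemma solution_exists: "\<exists>bs. solution w I bs"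
proof -
  define f where "f j = map (Pair j) (snd (I ! j))" for j :: nat
  define bs where "bs = map f [0..<length I]"
  have v: "valid_order w (snd (I ! j))" if "j < length I" for j using valid_orders that by simp
  have o: "orders_of (f j) = {j}" if "j < length I" for j
    using v[OF that] by (simp add: f_def orders_of_def valid_order_def image_image image_constant_conv)
  have "distinct (concat (map f js))" if "distinct js" "set js \<subseteq> {..<length I}" for js
    using that
  proof (induction js)
    case (Cons j js)
    then have "distinct (f j)" using v[of j] by (auto simp: f_def valid_order_def distinct_map inj_on_def)
    moreover have "set (f j) \<inter> set (concat (map f js)) = {}" using Cons.prems by (auto simp: f_def)
    ultimately show ?case using Cons by simp
  qed simp
  from this[of "[0..<length I]"] have "distinct (concat bs)" by (simp add: bs_def lessThan_atLeast0)
  moreover have "set (concat bs) = items I" by (auto simp: bs_def f_def items_def)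
  moreover have "unsplit bs"
    unfolding bs_def sorted_wrt_map
    by (rule sorted_wrt_mono_rel[of _ "(<)"]) (auto simp: o)
  moreover have "b \<noteq> [] \<and> card (orders_of b) \<le> capacity w" if b: "b \<in> set bs" for b
  proof -
    obtain j where j: "j < length I" "b = f j" using b by (auto simp: bs_def)
    then show ?thesis using v[OF j(1)] o[OF j(1)] cap_pos by (auto simp: f_def valid_order_def)
  qed
  ultimately show ?thesis unfolding solution_def batching_def by blast
qed

lemma finite_solutions: "finite {bs. solution w I bs}"
  by (rule finite_subset[OF _ finite_batchings[OF finite_items[of I]]])
    (auto simp: solution_def batching_def)

lemma ciopt_le: "solution w I bs \<Longrightarrow> ciopt w sys I \<le> completion w sys I (depot w) 0 (steps bs)"
  unfolding ciopt_def using finite_solutions by (intro Min_le) auto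

lemma ciopt_attained:
  "\<exists>bs. solution w I bs \<and> ciopt w sys I = completion w sys I (depot w) 0 (steps bs)"
proof -
  have "ciopt w sys I \<in> {completion w sys I (depot w) 0 (steps bs) |bs. solution w I bs}"
    unfolding ciopt_def using finite_solutions solution_exists by (intro Min_in) auto
  then show ?thesis by auto
qed

lemma solution_on_grid: "solution w I bs \<Longrightarrow> on_grid (steps bs)"
  using items_grid by (simp add: solution_def batching_def)

text \<open>What is needed of a situation for an optimal plan to exist.\<close>
definition admissible :: "situation \<Rightarrow> bool" where
  "admissible s \<longleftrightarrow> pos s \<in> G \<and> pending s \<subseteq> items I \<and> finite (cart s) \<and> card (cart s) \<le> capacity w"

lemma feasible_on_grid: "admissible s \<Longrightarrow> feasible w s bs \<Longrightarrow> on_grid (steps bs)"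
  using items_grid by (auto simp: admissible_def feasible_def batching_def)

text \<open>The plan that reoptimization is compared with: first the missing items of the orders in the
  cart, in any sequence, and then the batches of a solution of the complete instance, restricted to what is
  left.\<close>
lemma feasible_restrict:
  assumes s: "admissible s" and bs: "solution w I bs"
    and xs: "distinct xs" "set xs = {x \<in> pending s. fst x \<in> cart s}"
  shows "feasible w s (xs # filter (\<lambda>b. b \<noteq> []) (map (filter (\<lambda>x. x \<in> pending s \<and> fst x \<notin> cart s)) bs))"
proof -
  define P where "P x \<longleftrightarrow> x \<in> pending s \<and> fst x \<notin> cart s" for x
  define cs where "cs = filter (\<lambda>b. b \<noteq> []) (map (filter P) bs)"
  have b: "distinct (concat bs)" "set (concat bs) = items I" "unsplit bs"
    "\<And>b. b \<in> set bs \<Longrightarrow> card (orders_of b) \<le> capacity w"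
    using bs by (auto simp: solution_def batching_def)
  have c: "set (concat cs) = {x \<in> items I. P x}"
    unfolding cs_def restrict_batches(1) b(2) ..
  have cd: "distinct (concat cs)"
    unfolding cs_def by (rule restrict_batches(2)[OF b(1)])
  have c': "b \<noteq> [] \<and> (\<exists>b0\<in>set bs. b = filter P b0)" if "b \<in> set cs" for b
    using restrict_batches(3)[where P = P and bs = bs and b = b] that unfolding cs_def .
  have u: "unsplit cs" unfolding cs_def using unsplit_restrict b by blast
  have oc: "orders_of b \<inter> cart s = {}" if b: "b \<in> set cs" for b
  proof -
    obtain b0 where "b = filter P b0" using c'[OF b] by blast
    then show ?thesis by (auto simp: orders_of_def P_def)
  qed
  have ox: "orders_of xs \<subseteq> cart s" unfolding orders_of_def xs by blast
  have cc: "card (orders_of b) \<le> capacity w" if cs: "b \<in> set cs" for b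
  proof -
    obtain b0 where b0: "b0 \<in> set bs" "b = filter P b0" using c'[OF cs] by blast
    then have "card (orders_of b) \<le> card (orders_of b0)" by (intro card_mono) (auto simp: orders_of_def)
    with b(4)[OF b0(1)] show ?thesis by simp
  qed
  have "set xs \<inter> set (concat cs) = {}" unfolding xs c P_def by blast
  then have "distinct (concat (xs # cs))" using xs(1) cd by simp
  moreover have "set (concat (xs # cs)) = pending s"
  proof -
    have "set (concat (xs # cs)) = set xs \<union> set (concat cs)" by simp
    also have "\<dots> = {x \<in> pending s. fst x \<in> cart s} \<union> {x \<in> items I. P x}" by (simp only: xs c)
    also have "\<dots> = pending s" using s unfolding P_def admissible_def by blast
    finally show ?thesis .
  qed
  moreover have "unsplit (xs # cs)"
  proof -
    have "orders_of xs \<inter> orders_of b = {}" if "b \<in> set cs" for b using oc[OF that] ox by blast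
    with u show ?thesis by simp
  qed
  moreover have "cart s \<union> orders_of xs = cart s" using ox by blast
  moreover have "card (cart s) \<le> capacity w" using s by (simp add: admissible_def)
  moreover have "\<forall>b\<in>set cs. b \<noteq> [] \<and> orders_of b \<inter> cart s = {} \<and> card (orders_of b) \<le> capacity w"
    using oc cc c' by blast
  ultimately show ?thesis
    unfolding feasible_def batching_def P_def[symmetric] cs_def[symmetric] list.sel by simp
qed

text \<open>There are finitely many feasible plans and at least one, and each is realized by a route. The
  tie-breaking rule is constrained only where an optimal plan exists; this is the case in all situations
  that occur.\<close>
lemma sel_optimal:
  assumes "admissible s" shows "optimal_plan w sys s (sel s)"
proof -
  have fin: "finite (pending s)" by (rule finite_subset[OF _ finite_items[of I]]) (use assms in \<open>simp add: admissible_def\<close>)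
  have "finite {bs. feasible w s bs}"
  proof -
    define B where "B = {b. set b \<subseteq> pending s \<and> distinct b}"
    define BB where "BB = (\<Union>A\<in>Pow (pending s). {bs. distinct (concat bs) \<and> set (concat bs) = A \<and> [] \<notin> set bs})"
    have "finite B" using fin by (simp add: B_def finite_subset_distinct)
    moreover have "finite BB" unfolding BB_def
    proof (rule finite_UN_I)
      show "finite (Pow (pending s))" using fin by simp
      fix A assume "A \<in> Pow (pending s)"
      then have "finite A" using finite_subset[OF _ fin] by simp
      then show "finite {bs. distinct (concat bs) \<and> set (concat bs) = A \<and> [] \<notin> set bs}"
        by (rule finite_batchings)
    qed
    ultimately have fin2: "finite (case_prod (#) ` (B \<times> BB))" by (intro finite_imageI finite_cartesian_product)
    have "bs \<in> case_prod (#) ` (B \<times> BB)" if f: "feasible w s bs" for bs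
    proof -
      have "bs \<noteq> []" using f unfolding feasible_def by blast
      then obtain b bs' where bs: "bs = b # bs'" by (meson neq_Nil_conv)
      have 1: "distinct (concat bs)" "set (concat bs) = pending s" "[] \<notin> set bs'"
        using f unfolding feasible_def batching_def bs by auto
      then have "b \<in> B" unfolding B_def bs by auto
      moreover have "set (concat bs') \<subseteq> pending s" using 1(2) unfolding bs by auto
      then have "bs' \<in> BB" unfolding BB_def using 1(1,3) unfolding bs by simp
      ultimately show ?thesis unfolding bs by (intro image_eqI[of _ _ "(b, bs')"]) simp_all
    qed
    then have "{bs. feasible w s bs} \<subseteq> case_prod (#) ` (B \<times> BB)" by (intro subsetI) simp
    then show ?thesis using fin2 by (rule finite_subset)
  qed
  moreover have "{bs. feasible w s bs} \<noteq> {}"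
  proof -
    obtain bs where "solution w I bs" using solution_exists by blast
    moreover have "finite {x \<in> pending s. fst x \<in> cart s}" using fin by simp
    from finite_distinct_list[OF this] obtain xs where "set xs = {x \<in> pending s. fst x \<in> cart s}" "distinct xs"
      by blast
    ultimately have "feasible w s (xs # filter (\<lambda>b. b \<noteq> []) (map (filter (\<lambda>x. x \<in> pending s \<and> fst x \<notin> cart s)) bs))"
      by (intro feasible_restrict[OF assms])
    then have "xs # filter (\<lambda>b. b \<noteq> []) (map (filter (\<lambda>x. x \<in> pending s \<and> fst x \<notin> cart s)) bs) \<in> {bs. feasible w s bs}"
      by (rule CollectI)
    then show ?thesis by blast
  qed
  ultimately have F: "finite {bs. feasible w s bs}" "{bs. feasible w s bs} \<noteq> {}" .
  define bs where "bs = arg_min_on (\<lambda>bs. duration w sys (pos s) (steps bs)) {bs. feasible w s bs}"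
  have "bs \<in> {bs. feasible w s bs}"
    unfolding bs_def by (rule arg_min_if_finite(1)[OF F])
  then have bs: "feasible w s bs" by simp
  have opt: "duration w sys (pos s) (steps bs) \<le> duration w sys (pos s) (steps bs')" if "feasible w s bs'" for bs'
    unfolding bs_def by (rule arg_min_least[OF F]) (use that in simp)
  have "on_grid (steps bs)" using feasible_on_grid[OF assms bs] .
  then obtain \<gamma> where "route w sys (pos s) (steps bs) \<gamma>"
    using route_exists[of "pos s" "steps bs" sys] assms by (auto simp: admissible_def)
  then have "optimal_plan w sys s (bs, \<gamma>)" using bs opt by (simp add: optimal_plan_def)
  then show ?thesis by (rule tie[unfolded tie_breaking_def, rule_format, OF exI])
qed

end

section \<open>The online run\<close>

lemma length_takeWhile_mono:
  assumes "\<And>x. P x \<Longrightarrow> Q x"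
  shows "length (takeWhile P xs) \<le> length (takeWhile Q xs)"
  using assms by (induction xs) auto

context order_instance
begin

text \<open>The completion time here is the offline one, for the complete instance. Hence the invariant says
  that the online picker is never earlier than an offline picker who takes the same steps, with enough time
  left for the latter to catch up from her last stop to the current position of the former.\<close>
definition history :: "situation \<Rightarrow> item list list \<Rightarrow> item list \<Rightarrow> bool" where
  "history s fb cb \<longleftrightarrow> progress (known s) (pending s) (cart s) fb cb \<and>
     completion w sys I (depot w) 0 (steps fb @ map Pick cb)
       + d (stop sys (depot w) (steps fb @ map Pick cb)) (pos s) \<le> clock s"

text \<open>The last clause is for instances located at the depot only, where the pushcart never
  moves.\<close>
definition online_inv :: "situation \<Rightarrow> bool" where
  "online_inv s \<longleftrightarrow> known s = takeWhile (\<lambda>x. fst x \<le> clock s) I \<and> pos s \<in> G \<and>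
     (\<exists>fb cb. history s fb cb) \<and> (sys = PcartN \<longrightarrow> pos s = depot w \<and> cart s = {}) \<and>
     (sys \<noteq> Robot \<and> snd ` items I \<subseteq> {depot w} \<longrightarrow> pos s = depot w)"

lemma known_items:
  assumes "online_inv s" shows "items (known s) \<subseteq> items I"
proof -
  have "known s = takeWhile (\<lambda>x. fst x \<le> clock s) I" using assms by (simp add: online_inv_def)
  then have "known s = take (length (known s)) I" using takeWhile_eq_take by metis
  then show ?thesis using items_take[of "length (known s)" I] by auto
qed

lemma online_inv_history: "online_inv s \<Longrightarrow> \<exists>fb cb. history s fb cb"
  by (simp add: online_inv_def)

lemma known_released:
  assumes "online_inv s" "x \<in> items (known s)" shows "fst (I ! fst x) \<le> clock s"
proof -
  have k: "known s = takeWhile (\<lambda>x. fst x \<le> clock s) I" using assms by (simp add: online_inv_def)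
  have j: "fst x < length (known s)" using assms by (auto simp: items_def)
  then have "known s ! fst x \<in> set (known s)" by simp
  then have "fst (known s ! fst x) \<le> clock s" unfolding k by (auto dest: set_takeWhileD)
  moreover have "known s ! fst x = I ! fst x" using j unfolding k by (rule takeWhile_nth)
  ultimately show ?thesis by simp
qed

lemma history_on_grid:
  assumes "online_inv s" "history s fb cb" shows "on_grid (steps fb @ map Pick cb)"
proof -
  have "set (concat fb @ cb) \<subseteq> items I"
    using assms known_items[of s] by (auto simp: history_def progress_def)
  then have "snd ` set (concat fb @ cb) \<subseteq> G" using items_grid by blast
  then show ?thesis by auto
qed

lemma online_inv_admissible:
  assumes "online_inv s" shows "admissible s"
proof -
  obtain fb cb where "progress (known s) (pending s) (cart s) fb cb"
    using online_inv_history[OF assms] unfolding history_def by blast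
  then have "pending s \<subseteq> items (known s)" "finite (cart s)" "card (cart s) \<le> capacity w"
    by (auto simp: progress_def)
  then show ?thesis using assms known_items[OF assms] by (auto simp: online_inv_def admissible_def)
qed

lemma pending_released:
  assumes "online_inv s" "x \<in> pending s" shows "fst (I ! fst x) \<le> clock s"
proof -
  have "x \<in> items (known s)" using assms by (auto simp: online_inv_def history_def progress_def)
  then show ?thesis using known_released assms(1) by blast
qed

lemma d_depot_pos_le_clock:
  assumes "online_inv s" shows "d (depot w) (pos s) \<le> clock s"
proof -
  obtain fb cb where h: "history s fb cb" using assms by (auto simp: online_inv_def)
  define es where "es = steps fb @ map Pick cb"
  have es: "on_grid es" using history_on_grid[OF assms h] by (simp add: es_def)
  define e where "e = stop sys (depot w) es"
  have e: "e \<in> G" unfolding e_def by (rule stop_grid[OF depot_grid es])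
  have p: "pos s \<in> G" using assms by (simp add: online_inv_def)
  have "d (depot w) (pos s) \<le> d (depot w) e + d e (pos s)"
    by (rule d_triangle[OF depot_grid e p])
  moreover have "d (depot w) e \<le> duration w sys (depot w) es"
    unfolding e_def by (rule d_stop_le_duration[OF depot_grid es])
  moreover have "0 + duration w sys (depot w) es \<le> completion w sys I (depot w) 0 es"
    by (rule completion_ge[OF depot_grid es])
  moreover have "completion w sys I (depot w) 0 es + d e (pos s) \<le> clock s"
    using h by (simp add: history_def es_def e_def)
  ultimately show ?thesis by linarith
qed

text \<open>Entering the newly arrived orders changes neither the picker's past nor her position.\<close>
lemma online_inv_reveal:
  assumes k: "known s = takeWhile (\<lambda>x. fst x \<le> c) I" and c: "c \<le> clock s" and p: "pos s \<in> G"
    and h: "history s fb cb" and N: "sys = PcartN \<longrightarrow> pos s = depot w \<and> cart s = {}"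
    and dg: "sys \<noteq> Robot \<and> snd ` items I \<subseteq> {depot w} \<longrightarrow> pos s = depot w"
  shows "online_inv (reveal I s)"
proof -
  define K where "K = takeWhile (\<lambda>x. fst x \<le> clock s) I"
  define m where "m = length (known s)"
  have km: "known s = take m I" unfolding m_def k by (rule takeWhile_eq_take)
  have Km: "K = take (length K) I" unfolding K_def by (rule takeWhile_eq_take)
  have "m \<le> length K" unfolding m_def k K_def using c by (intro length_takeWhile_mono) auto
  moreover have "progress (take m I) (pending s) (cart s) fb cb" using h km by (simp add: history_def)
  ultimately have "progress (take (length K) I)
    (pending s \<union> {x \<in> items (take (length K) I). length (take m I) \<le> fst x}) (cart s) fb cb"
    by (rule progress_reveal[rotated])
  then have "progress K (pending s \<union> {x \<in> items K. length (known s) \<le> fst x}) (cart s) fb cb"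
    by (simp only: Km[symmetric] km[symmetric])
  then have "history (reveal I s) fb cb"
    using h by (simp add: history_def reveal_def Let_def K_def)
  then show ?thesis using p N dg by (auto simp: online_inv_def reveal_def Let_def)
qed

lemma online_inv_init:
  "online_inv (reveal I \<lparr>clock = 0, known = [], pos = depot w, cart = {}, pending = {}\<rparr>)"
\<comment> \<open>before time 0 nothing is known; \<open>-1\<close> is any negative time\<close>
proof (rule online_inv_reveal[where c = "-1" and fb = "[]" and cb = "[]"])
  show "known \<lparr>clock = 0, known = [], pos = depot w, cart = {}, pending = {}\<rparr> = takeWhile (\<lambda>x. fst x \<le> -1) I"
    using times_nonneg by (cases I) fastforce+
qed (auto simp: history_def progress_def depot_grid items_def)

text \<open>The plan is interrupted at time \<open>r\<close>, in general between two stops. The first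
  \<open>k\<close> steps are over, and since the route moves at speed at most one, the time since the last
  stop pays for the distance to it.\<close>
lemma follow_interventionist:
  assumes s: "online_inv s" and r: "clock s \<le> r" and sys: "sys \<noteq> PcartN"
  defines "s' \<equiv> follow w sys (sel s) r s"
  shows "\<exists>fb cb. history s' fb cb" "pos s' \<in> G" "clock s' = r" "known s' = known s"
    "sys \<noteq> Robot \<and> snd ` items I \<subseteq> {depot w} \<longrightarrow> pos s' = depot w"
proof -
  define bs where "bs = fst (sel s)"
  define \<gamma> where "\<gamma> = snd (sel s)"
  define u where "u = r - clock s"
  have u: "0 \<le> u" using r by (simp add: u_def)
  have adm: "admissible s" by (rule online_inv_admissible[OF s])
  have "optimal_plan w sys s (sel s)" by (rule sel_optimal[OF adm])
  then have f: "feasible w s bs" and rt: "route w sys (pos s) (steps bs) \<gamma>"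
    by (auto simp: optimal_plan_def bs_def \<gamma>_def)
  have og: "on_grid (steps bs)" by (rule feasible_on_grid[OF adm f])
  obtain C Q where CQ: "advance w sys u (pos s) (steps bs) (cart s) (pending s) = (C, Q)" by fastforce
  have s': "s' = s\<lparr>clock := r, pos := \<gamma> u, cart := C, pending := Q\<rparr>"
    using CQ sys by (simp add: s'_def follow_def bs_def \<gamma>_def u_def Let_def)
  show "clock s' = r" "known s' = known s" by (simp_all add: s')
  have \<gamma>u: "\<gamma> u \<in> G" by (rule route_grid[OF rt u])
  then show "pos s' \<in> G" by (simp add: s')
  have p: "pos s \<in> G" using s by (simp add: online_inv_def)
  obtain fb cb where h: "history s fb cb" using s by (auto simp: online_inv_def)
  then have P: "progress (known s) (pending s) (cart s) fb cb" by (simp add: history_def)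
  have part: "partition (known s) (fb @ (cb @ hd bs) # tl bs)" by (rule progress_partition[OF P f])
  have "bs \<noteq> []" "set (concat bs) = pending s" using f by (auto simp: feasible_def batching_def)
  moreover have "cart s = orders_of cb" using P by (simp add: progress_def)
  ultimately obtain fb' cb' k where k: "progress (known s) Q C fb' cb'" "k \<le> length (steps bs)"
      "steps fb' @ map Pick cb' = steps fb @ map Pick cb @ take k (steps bs)"
      "duration w sys (pos s) (take k (steps bs)) \<le> u"
    using advance_progress[OF _ part u, of sys "pos s" C Q] CQ by auto
  define es where "es = steps fb @ map Pick cb"
  define es' where "es' = take k (steps bs)"
  define e where "e = stop sys (depot w) es"
  define \<tau> where "\<tau> = completion w sys I (depot w) 0 es"
  have eg: "e \<in> G" unfolding e_def es_def by (rule stop_grid[OF depot_grid history_on_grid[OF s h]])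
  have og': "on_grid es'" unfolding es'_def by (rule on_grid_take[OF og])
  have \<tau>: "\<tau> + d e (pos s) \<le> clock s" using h by (simp add: history_def \<tau>_def e_def es_def)
  have rel: "fst (I ! fst x) \<le> clock s" if "Pick x \<in> set es'" for x
  proof -
    have "Pick x \<in> set (steps bs)" using that unfolding es'_def by (rule in_set_takeD)
    moreover have "set (concat bs) = pending s" using f by (simp add: feasible_def batching_def)
    ultimately have "x \<in> pending s" unfolding Pick_in_steps by blast
    then show ?thesis by (rule pending_released[OF s])
  qed
  have 1: "completion w sys I e \<tau> es' + d (stop sys e es') (stop sys (pos s) es')
      \<le> clock s + duration w sys (pos s) es'"
    by (rule completion_released[OF og' eg p \<tau> rel])
  have 2: "\<gamma> (duration w sys (pos s) es') = stop sys (pos s) es'"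
    using rt k(2) unfolding route_def es'_def by blast
  have 3: "d (stop sys (pos s) es') (\<gamma> u) \<le> u - duration w sys (pos s) es'"
    unfolding 2[symmetric] using k(4) duration_nonneg[OF p og', of sys]
    by (intro route_speed[OF rt]) (auto simp: es'_def)
  have 4: "d (stop sys e es') (\<gamma> u) \<le> d (stop sys e es') (stop sys (pos s) es') + d (stop sys (pos s) es') (\<gamma> u)"
    by (rule d_triangle[OF stop_grid[OF eg og'] stop_grid[OF p og'] \<gamma>u])
  have "steps fb' @ map Pick cb' = es @ es'" using k(3) by (simp add: es_def es'_def)
  then have "completion w sys I (depot w) 0 (steps fb' @ map Pick cb')
       + d (stop sys (depot w) (steps fb' @ map Pick cb')) (\<gamma> u) \<le> r"
    using 1 3 4 by (simp add: completion_append e_def[symmetric] \<tau>_def[symmetric] u_def)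
  then have "history s' fb' cb'" using k(1) by (simp add: history_def s')
  then show "\<exists>fb cb. history s' fb cb" by blast
  show "sys \<noteq> Robot \<and> snd ` items I \<subseteq> {depot w} \<longrightarrow> pos s' = depot w"
  proof (intro impI, elim conjE)
    assume dg: "sys \<noteq> Robot" "snd ` items I \<subseteq> {depot w}"
    then have ps: "pos s = depot w" using s by (simp add: online_inv_def)
    have at: "snd x = depot w" if "Pick x \<in> set (steps bs)" for x
    proof -
      have "set (concat bs) \<subseteq> items I" using f adm by (simp add: feasible_def batching_def admissible_def)
      then have "x \<in> items I" using that unfolding Pick_in_steps by blast
      then show ?thesis using dg(2) by blast
    qed
    have "duration w sys (depot w) (steps bs) = 0" by (rule duration_at_depot[OF dg(1) at])
    then have "\<gamma> u = stop sys (depot w) (steps bs)"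
      using rt u unfolding route_def ps by simp
    also have "\<dots> = depot w" by (rule stop_at_depot[OF dg(1) at])
    finally show "pos s' = depot w" by (simp add: s')
  qed
qed

text \<open>Without intervention each batch starts and ends at the depot, so that a batch of an optimal plan
  can be replaced by any other tour through the same items and is therefore no longer than it.\<close>
lemma optimal_batch_short:
  assumes s: "online_inv s" and N: "sys = PcartN" and B: "tourable sys (items I) B"
    and b: "b \<in> set (fst (sel s))"
  shows "duration w sys (depot w) (steps [b]) \<le> B"
proof -
  have adm: "admissible s" by (rule online_inv_admissible[OF s])
  have pos: "pos s = depot w" and cart: "cart s = {}" using s N unfolding online_inv_def by blast+
  have opt: "optimal_plan w sys s (sel s)" by (rule sel_optimal[OF adm])
  then have f: "feasible w s (fst (sel s))" by (simp add: optimal_plan_def)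
  obtain us vs where bs: "fst (sel s) = us @ b # vs" using b by (meson split_list)
  have "set (concat (fst (sel s))) = pending s" using f unfolding feasible_def batching_def by blast
  then have "set b \<subseteq> pending s" unfolding bs by auto
  also have "pending s \<subseteq> items I" using adm by (simp add: admissible_def)
  finally obtain xs where xs: "distinct xs" "set xs = set b"
    "duration w sys (depot w) (map Pick xs @ [Close]) \<le> B"
    using B[unfolded tourable_def, rule_format, of "set b"] by blast
  have xsB: "duration w sys (depot w) (steps [xs]) \<le> B" using xs(3) by simp
  have o: "orders_of xs = orders_of b" using xs by (simp add: orders_of_def)
  have ne: "xs = [] \<longleftrightarrow> b = []" using xs(2) by (metis set_empty)
  have "feasible w s (us @ xs # vs)"
  proof (cases us)
    case Nil
    then show ?thesis using f o xs(1,2) ne unfolding bs feasible_def batching_def by simp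
  next
    case (Cons u us')
    then show ?thesis using f o xs(1,2) ne unfolding bs feasible_def batching_def
      by (simp add: sorted_wrt_append)
  qed
  then have "duration w sys (depot w) (steps (us @ b # vs)) \<le> duration w sys (depot w) (steps (us @ xs # vs))"
    using opt unfolding optimal_plan_def bs pos by blast
  moreover have dec: "duration w sys (depot w) (steps (us @ y # vs)) = duration w sys (depot w) (steps us) +
    duration w sys (depot w) (steps [y]) + duration w sys (depot w) (steps vs)" for y
  proof -
    have "steps (us @ y # vs) = steps us @ steps [y] @ steps vs" by simp
    moreover have "stop sys (depot w) (steps us) = depot w" "stop sys (depot w) (steps [y]) = depot w"
      using N by (simp_all add: stop_steps_depot del: steps_Cons)
    ultimately show ?thesis by (simp only: duration_append)
  qed
  ultimately show ?thesis using xsB dec[of b] dec[of xs] by linarith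
qed

lemma follow_noninterventionist:
  assumes s: "online_inv s" and r: "clock s \<le> r" and sys: "sys = PcartN"
  defines "s' \<equiv> follow w sys (sel s) r s"
  shows "\<exists>fb cb. history s' fb cb" "pos s' = depot w" "cart s' = {}" "r \<le> clock s'" "known s' = known s"
    and "tourable sys (items I) B \<Longrightarrow> 0 \<le> B \<Longrightarrow> clock s' \<le> r + B"
proof -
  define bs where "bs = fst (sel s)"
  have adm: "admissible s" by (rule online_inv_admissible[OF s])
  have pos: "pos s = depot w" and cart: "cart s = {}" using s sys unfolding online_inv_def by blast+
  have "optimal_plan w sys s (sel s)" by (rule sel_optimal[OF adm])
  then have f: "feasible w s bs" by (simp add: optimal_plan_def bs_def)
  have og: "on_grid (steps bs)" by (rule feasible_on_grid[OF adm f])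
  obtain \<tau> bs' where sv: "serve w (clock s) bs r = (\<tau>, bs')" by fastforce
  have s': "s' = s\<lparr>clock := \<tau>, pending := set (concat bs')\<rparr>"
    using sv sys by (simp add: s'_def follow_def bs_def Let_def)
  show "pos s' = depot w" "cart s' = {}" "known s' = known s" using pos cart by (simp_all add: s')
  obtain dn where dn: "bs = dn @ bs'" "r \<le> \<tau>" "clock s + duration w PcartN (depot w) (steps dn) \<le> \<tau>"
    using serve_prefix[OF sv] by blast
  show "r \<le> clock s'" using dn by (simp add: s')
  obtain fb cb where h: "history s fb cb" using online_inv_history[OF s] by blast
  then have P: "progress (known s) (pending s) (cart s) fb cb" by (simp add: history_def)
  then have cb: "cb = []" using cart by (simp add: progress_def orders_of_def)
  have bs: "bs \<noteq> []" using f by (simp add: feasible_def)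
  have "partition (known s) (fb @ (cb @ hd bs) # tl bs)" by (rule progress_partition[OF P f])
  then have "partition (known s) ((fb @ dn) @ bs')" using bs cb dn(1) by simp
  then have P': "progress (known s) (set (concat bs')) {} (fb @ dn) []"
  proof (cases bs')
    case Nil
    from partition_append_Nil[OF \<open>partition (known s) ((fb @ dn) @ bs')\<close>]
    have "partition (known s) ((fb @ dn) @ ([] @ []) # [])" using Nil by simp
    from partition_progress[OF this] show ?thesis using Nil by simp
  next
    case (Cons b bs'')
    have "partition (known s) ((fb @ dn) @ ([] @ b) # bs'')"
      using \<open>partition (known s) ((fb @ dn) @ bs')\<close> Cons by simp
    from partition_progress[OF this] show ?thesis using Cons by simp
  qed
  have st: "stop sys (depot w) (steps fb) = depot w" "stop sys (depot w) (steps (fb @ dn)) = depot w"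
    by (rule stop_steps_depot; simp add: sys)+
  have c: "completion w sys I (depot w) 0 (steps fb) \<le> clock s"
    using h pos cb st depot_grid by (simp add: history_def)
  have ogd: "on_grid (steps dn)" using og unfolding dn(1) by simp
  have rel: "fst (I ! fst x) \<le> clock s" if "Pick x \<in> set (steps dn)" for x
  proof -
    have "Pick x \<in> set (steps bs)" using that unfolding dn(1) by simp
    moreover have "set (concat bs) = pending s" using f by (simp add: feasible_def batching_def)
    ultimately have "x \<in> pending s" unfolding Pick_in_steps by blast
    then show ?thesis by (rule pending_released[OF s])
  qed
  have "completion w sys I (depot w) (completion w sys I (depot w) 0 (steps fb)) (steps dn)
      + d (stop sys (depot w) (steps dn)) (stop sys (depot w) (steps dn))
      \<le> clock s + duration w sys (depot w) (steps dn)"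
    by (rule completion_released[OF ogd depot_grid depot_grid _ rel]) (use c depot_grid in simp_all)
  moreover have "stop sys (depot w) (steps dn) = depot w" by (rule stop_steps_depot) (simp add: sys)
  ultimately have "completion w sys I (depot w) 0 (steps (fb @ dn)) \<le> \<tau>"
    using dn(3) st(1) depot_grid sys by (simp add: completion_append)
  then have "history s' (fb @ dn) []"
    using P' st(2) pos cart depot_grid by (simp add: history_def s')
  then show "\<exists>fb cb. history s' fb cb" by blast
  show "clock s' \<le> r + B" if "tourable sys (items I) B" "0 \<le> B"
  proof -
    have "duration w PcartN (depot w) (steps [b]) \<le> B" if b: "b \<in> set bs" for b
      using optimal_batch_short[OF s sys \<open>tourable sys (items I) B\<close>] b unfolding bs_def sys by blast
    from serve_clock[OF sv that(2) _ this] show ?thesis using r that(2) by (simp add: s')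
  qed
qed

lemma online_inv_step:
  assumes s: "online_inv s" and r: "clock s \<le> r"
  defines "s' \<equiv> reveal I (follow w sys (sel s) r s)"
  shows "online_inv s'" "r \<le> clock s'" "tourable sys (items I) B \<Longrightarrow> 0 \<le> B \<Longrightarrow> clock s' \<le> r + B"
proof -
  let ?f = "follow w sys (sel s) r s"
  have ck: "clock s' = clock ?f" by (simp add: s'_def reveal_def Let_def)
  have k: "known s = takeWhile (\<lambda>x. fst x \<le> clock s) I" using s by (simp add: online_inv_def)
  have "online_inv s' \<and> r \<le> clock s' \<and> (tourable sys (items I) B \<longrightarrow> 0 \<le> B \<longrightarrow> clock s' \<le> r + B)"
  proof (cases "sys = PcartN")
    case True
    note F = follow_noninterventionist[OF s r True]
    obtain fb cb where h: "history ?f fb cb" using F(1) by blast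
    have "online_inv s'" unfolding s'_def
    proof (rule online_inv_reveal[OF _ _ _ h])
      show "known ?f = takeWhile (\<lambda>x. fst x \<le> clock s) I" using F(5) k by simp
      show "clock s \<le> clock ?f" using F(4) r by linarith
      show "pos ?f \<in> G" using F(2) depot_grid by simp
    qed (use F(2,3) in blast)+
    then show ?thesis unfolding ck using F(4) F(6)[of B] by blast
  next
    case False
    note F = follow_interventionist[OF s r False]
    obtain fb cb where h: "history ?f fb cb" using F(1) by blast
    have "online_inv s'" unfolding s'_def
      by (rule online_inv_reveal[of _ "clock s" fb cb]) (use F(2-5) r k h False in simp_all)
    then show ?thesis unfolding ck F(3) by simp
  qed
  then show "online_inv s'" "r \<le> clock s'" "tourable sys (items I) B \<Longrightarrow> 0 \<le> B \<Longrightarrow> clock s' \<le> r + B"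
    by blast+
qed

text \<open>All arrivals are processed when the run ends, and the last reoptimization takes place at an
  arrival or, without intervention, at the end of the batch that was in progress then.\<close>
lemma run_final:
  assumes "online_inv s" "tourable sys (items I) B" "0 \<le> B"
  shows "\<exists>s'. online_inv s' \<and>
    run w sys sel I rs s = clock s' + duration w sys (pos s') (steps (fst (sel s'))) \<and>
    (\<forall>r\<in>set rs. r \<le> clock s') \<and> clock s \<le> clock s' \<and>
    (clock s' = clock s \<or> (\<exists>r\<in>set rs. clock s' \<le> r + B))"
  using assms(1)
proof (induction rs arbitrary: s)
  case Nil then show ?case by (intro exI[of _ s]) simp
next
  case (Cons r rs)
  define s1 where "s1 = (if r \<le> clock s then s else reveal I (follow w sys (sel s) r s))"
  have s1: "online_inv s1" "r \<le> clock s1" "clock s \<le> clock s1" "clock s1 = clock s \<or> clock s1 \<le> r + B"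
  proof -
    have *: "online_inv s1 \<and> r \<le> clock s1 \<and> clock s \<le> clock s1 \<and> (clock s1 = clock s \<or> clock s1 \<le> r + B)"
    proof (cases "r \<le> clock s")
      case True then show ?thesis using Cons.prems by (simp add: s1_def)
    next
      case False
      then have r: "clock s \<le> r" by simp
      have "s1 = reveal I (follow w sys (sel s) r s)" using False by (simp add: s1_def)
      then show ?thesis using online_inv_step(1,2)[OF Cons.prems r] online_inv_step(3)[OF Cons.prems r assms(2,3)] r by simp
    qed
    then show "online_inv s1" "r \<le> clock s1" "clock s \<le> clock s1" "clock s1 = clock s \<or> clock s1 \<le> r + B"
      by blast+
  qed
  from Cons.IH[OF s1(1)] obtain s' where s': "online_inv s'"
    "run w sys sel I rs s1 = clock s' + duration w sys (pos s') (steps (fst (sel s')))"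
    "\<forall>r\<in>set rs. r \<le> clock s'" "clock s1 \<le> clock s'"
    "clock s' = clock s1 \<or> (\<exists>r\<in>set rs. clock s' \<le> r + B)" by blast
  have "run w sys sel I (r # rs) s = run w sys sel I rs s1" by (simp add: s1_def)
  moreover have "clock s' = clock s \<or> (\<exists>r\<in>set (r # rs). clock s' \<le> r + B)"
    using s'(5) s1(4) by auto
  moreover have "\<forall>r\<in>set (r # rs). r \<le> clock s'" using s'(3,4) s1(2) by auto
  moreover have "clock s \<le> clock s'" using s1(3) s'(4) by linarith
  ultimately show ?case using s'(1,2) by (intro exI[of _ s']) simp
qed

lemma reopt_final:
  assumes "tourable sys (items I) B" "0 \<le> B"
  shows "\<exists>s. online_inv s \<and> known s = I \<and>
    reopt w sys sel I = clock s + duration w sys (pos s) (steps (fst (sel s))) \<and>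
    (clock s = 0 \<or> (\<exists>x\<in>set I. clock s \<le> fst x + B))"
proof -
  let ?s = "reveal I \<lparr>clock = 0, known = [], pos = depot w, cart = {}, pending = {}\<rparr>"
  have c: "clock ?s = 0" by (simp add: reveal_def Let_def)
  obtain s where s: "online_inv s"
    "reopt w sys sel I = clock s + duration w sys (pos s) (steps (fst (sel s)))"
    "\<forall>r\<in>set (map fst I). r \<le> clock s"
    "clock s = 0 \<or> (\<exists>r\<in>set (map fst I). clock s \<le> r + B)"
    using run_final[OF online_inv_init assms, of "map fst I"] unfolding reopt_def c by blast
  have "known s = I" using s(1,3) by (simp add: online_inv_def)
  moreover have "clock s = 0 \<or> (\<exists>x\<in>set I. clock s \<le> fst x + B)" using s(4) by simp
  ultimately show ?thesis using s(1,2) by blast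
qed

section \<open>Reoptimization against complete information\<close>

lemma tourable_exists: "tourable sys (items I) tour_const"
  by (rule tourable_const[OF finite_items items_aisles])

text \<open>What has been carried out before the last reoptimization and the final plan together form a
  solution of the instance, and performing it offline takes no longer than the online run.\<close>
lemma ciopt_le_reopt: "ciopt w sys I \<le> reopt w sys sel I"
proof -
  obtain s where s: "online_inv s" "known s = I"
    "reopt w sys sel I = clock s + duration w sys (pos s) (steps (fst (sel s)))"
    using reopt_final[OF tourable_exists tour_const_nonneg] by blast
  define bs where "bs = fst (sel s)"
  have adm: "admissible s" by (rule online_inv_admissible[OF s(1)])
  have "optimal_plan w sys s (sel s)" by (rule sel_optimal[OF adm])
  then have f: "feasible w s bs" by (simp add: optimal_plan_def bs_def)
  have og: "on_grid (steps bs)" by (rule feasible_on_grid[OF adm f])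
  have p: "pos s \<in> G" using s(1) by (simp add: online_inv_def)
  obtain fb cb where h: "history s fb cb" using online_inv_history[OF s(1)] by blast
  then have P: "progress (known s) (pending s) (cart s) fb cb" by (simp add: history_def)
  define A where "A = fb @ (cb @ hd bs) # tl bs"
  have A: "partition I A" using progress_partition[OF P f] by (simp add: A_def s(2))
  have "bs \<noteq> []" using f by (simp add: feasible_def)
  then have stA: "steps A = (steps fb @ map Pick cb) @ steps bs" by (cases bs) (simp_all add: A_def)
  define es where "es = steps fb @ map Pick cb"
  have ge: "on_grid es" unfolding es_def by (rule history_on_grid[OF s(1) h])
  have rel: "fst (I ! fst x) \<le> clock s" if "Pick x \<in> set (steps bs)" for x
  proof -
    have "set (concat bs) = pending s" using f by (simp add: feasible_def batching_def)
    then have "x \<in> pending s" using that unfolding Pick_in_steps by blast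
    then show ?thesis by (rule pending_released[OF s(1)])
  qed
  let ?e = "stop sys (depot w) es"
  have e: "?e \<in> G" by (rule stop_grid[OF depot_grid ge])
  have "completion w sys I ?e (completion w sys I (depot w) 0 es) (steps bs)
      + d (stop sys ?e (steps bs)) (stop sys (pos s) (steps bs)) \<le> clock s + duration w sys (pos s) (steps bs)"
    by (rule completion_released[OF og e p _ rel]) (use h in \<open>simp_all add: history_def es_def\<close>)
  moreover have "0 \<le> d (stop sys ?e (steps bs)) (stop sys (pos s) (steps bs))"
    by (rule d_nonneg[OF stop_grid[OF e og] stop_grid[OF p og]])
  ultimately have "completion w sys I (depot w) 0 (steps A) \<le> reopt w sys sel I"
    unfolding stA s(3) es_def[symmetric] completion_append bs_def by linarith
  moreover have "completion w sys I (depot w) 0 (steps (filter (\<lambda>b. b \<noteq> []) A)) \<le> completion w sys I (depot w) 0 (steps A)"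
    using og ge depot_grid by (intro completion_subseq subseq_steps_filter) (simp_all only: stA es_def[symmetric] on_grid_simps d_refl)
  moreover have "ciopt w sys I \<le> completion w sys I (depot w) 0 (steps (filter (\<lambda>b. b \<noteq> []) A))"
    by (rule ciopt_le[OF solution_partition[OF A]])
  ultimately show ?thesis by linarith
qed

text \<open>The final plan is compared with the restriction of the solution \<open>bs\<close>. The way from
  the present position to the depot is paid for at most three times: once to reach the tour through the
  missing items of the cart, which is estimated from the depot, and twice on the way from the end of this
  tour to the depot, which is estimated by going back along the tour. The tour and its way back account for
  \<open>2 * B\<close>.\<close>
lemma reopt_le:
  assumes B: "tourable sys (items I) B" "0 \<le> B" and bs: "solution w I bs"
  shows "\<exists>s. online_inv s \<and> (clock s = 0 \<or> (\<exists>x\<in>set I. clock s \<le> fst x + B)) \<and>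
     reopt w sys sel I \<le> clock s + 3 * d (depot w) (pos s) + 2 * B + duration w sys (depot w) (steps bs)"
proof -
  obtain s where s: "online_inv s" "known s = I"
    "reopt w sys sel I = clock s + duration w sys (pos s) (steps (fst (sel s)))"
    "clock s = 0 \<or> (\<exists>x\<in>set I. clock s \<le> fst x + B)"
    using reopt_final[OF B] by blast
  have adm: "admissible s" by (rule online_inv_admissible[OF s(1)])
  have p: "pos s \<in> G" using s(1) by (simp add: online_inv_def)
  let ?Q = "{x \<in> pending s. fst x \<in> cart s}"
  have Q: "?Q \<subseteq> items I" using adm unfolding admissible_def by blast
  obtain xs where xs: "distinct xs" "set xs = ?Q"
    "duration w sys (depot w) (map Pick xs @ [Close]) \<le> B"
    using B(1)[unfolded tourable_def, rule_format, OF Q] by blast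
  define P where "P x \<longleftrightarrow> x \<in> pending s \<and> fst x \<notin> cart s" for x
  define cs where "cs = filter (\<lambda>b. b \<noteq> []) (map (filter P) bs)"
  have f: "feasible w s (xs # cs)"
    unfolding cs_def P_def by (rule feasible_restrict[OF adm bs xs(1,2)])
  have "optimal_plan w sys s (sel s)" by (rule sel_optimal[OF adm])
  then have 1: "duration w sys (pos s) (steps (fst (sel s))) \<le> duration w sys (pos s) (steps (xs # cs))"
    using f unfolding optimal_plan_def by blast
  define es where "es = map Pick xs @ [Close]"
  define e where "e = stop sys (pos s) es"
  have "snd ` set xs \<subseteq> G" using xs(2) Q items_grid by blast
  then have ge: "on_grid es" by (simp add: es_def)
  have e: "e \<in> G" unfolding e_def by (rule stop_grid[OF p ge])
  have ob: "on_grid (steps bs)" by (rule solution_on_grid[OF bs])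
  have "steps (xs # cs) = es @ steps cs" by (simp add: es_def)
  then have 2: "duration w sys (pos s) (steps (xs # cs)) = duration w sys (pos s) es + duration w sys e (steps cs)"
    by (simp only: duration_append e_def)
  have 3: "duration w sys (pos s) es \<le> d (pos s) (depot w) + duration w sys (depot w) es"
    by (rule duration_subseq[OF _ ge p depot_grid]) simp
  have "subseq (steps cs) (steps (map (filter P) bs))" unfolding cs_def by (rule subseq_steps_filter)
  also have "subseq \<dots> (steps bs)" by (rule subseq_steps_restrict)
  finally have 4: "duration w sys e (steps cs) \<le> d e (depot w) + duration w sys (depot w) (steps bs)"
    by (rule duration_subseq[OF _ ob e depot_grid])
  have 5: "d (pos s) e \<le> duration w sys (pos s) es" unfolding e_def by (rule d_stop_le_duration[OF p ge])
  have 6: "d e (depot w) \<le> d e (pos s) + d (pos s) (depot w)" by (rule d_triangle[OF e p depot_grid])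
  have 7: "d e (pos s) = d (pos s) e" "d (pos s) (depot w) = d (depot w) (pos s)"
    by (rule d_sym[OF e p], rule d_sym[OF p depot_grid])
  have "reopt w sys sel I \<le> clock s + 3 * d (depot w) (pos s) + 2 * B + duration w sys (depot w) (steps bs)"
    using 1 2 3 4 5 6 7 xs(3)[folded es_def] s(3) by linarith
  then show ?thesis using s(1,4) by blast
qed

lemma release_le_ciopt:
  assumes x: "x \<in> set I" shows "fst x \<le> ciopt w sys I"
proof -
  obtain bs where bs: "solution w I bs" "ciopt w sys I = completion w sys I (depot w) 0 (steps bs)"
    using ciopt_attained by blast
  obtain j where j: "j < length I" "x = I ! j" using x by (metis in_set_conv_nth)
  have "snd x \<noteq> []" using valid_orders[OF x] by (simp add: valid_order_def)
  then have "(j, hd (snd x)) \<in> items I" using j by (simp add: items_def)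
  then have "Pick (j, hd (snd x)) \<in> set (steps bs)"
    unfolding Pick_in_steps using bs(1) by (simp add: solution_def batching_def)
  from completion_ge_release[OF depot_grid solution_on_grid[OF bs(1)] this]
  show ?thesis by (simp add: bs(2) j)
qed

lemma ciopt_nonneg: "0 \<le> ciopt w sys I"
proof -
  obtain bs where bs: "solution w I bs" "ciopt w sys I = completion w sys I (depot w) 0 (steps bs)"
    using ciopt_attained by blast
  show ?thesis unfolding bs(2) by (rule completion_ge_start[OF depot_grid solution_on_grid[OF bs(1)]])
qed

lemma optimal_duration:
  "\<exists>bs. solution w I bs \<and> duration w sys (depot w) (steps bs) \<le> ciopt w sys I"
proof -
  obtain bs where bs: "solution w I bs" "ciopt w sys I = completion w sys I (depot w) 0 (steps bs)"
    using ciopt_attained by blast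
  have "0 + duration w sys (depot w) (steps bs) \<le> ciopt w sys I"
    unfolding bs(2) by (rule completion_ge[OF depot_grid solution_on_grid[OF bs(1)]])
  then show ?thesis using bs(1) by auto
qed

text \<open>Any items can be collected in one batch by following an optimal solution and skipping all other
  items and the intermediate returns.\<close>
lemma tourable_ciopt: "tourable sys (items I) (ciopt w sys I)"
  unfolding tourable_def
proof (intro allI impI)
  fix Q assume Q: "Q \<subseteq> items I"
  obtain bs where bs: "solution w I bs" "duration w sys (depot w) (steps bs) \<le> ciopt w sys I"
    using optimal_duration by blast
  define xs where "xs = filter (\<lambda>x. x \<in> Q) (concat bs)"
  have b: "distinct (concat bs)" "set (concat bs) = items I" using bs(1) by (simp_all add: solution_def batching_def)
  have "set xs = Q" using Q unfolding xs_def set_filter b(2) by blast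
  moreover have "distinct xs" using b(1) unfolding xs_def by (rule distinct_filter)
  moreover have "duration w sys (depot w) (map Pick xs @ [Close]) \<le> ciopt w sys I"
  proof (cases "bs = []")
    case True
    then show ?thesis using ciopt_nonneg depot_grid by (simp add: xs_def)
  next
    case False
    have "duration w sys (depot w) (map Pick xs @ [Close]) \<le> d (depot w) (depot w) + duration w sys (depot w) (steps bs)"
      unfolding xs_def by (rule duration_subseq[OF subseq_tour[OF False] solution_on_grid[OF bs(1)] depot_grid depot_grid])
    then show ?thesis using bs(2) depot_grid by simp
  qed
  ultimately show "\<exists>xs. distinct xs \<and> set xs = Q \<and>
     duration w sys (depot w) (map Pick xs @ [Close]) \<le> ciopt w sys I" by blast
qed

text \<open>With \<open>B = CIOPT\<close>, the last reoptimization takes place by \<open>2 CIOPT\<close>, as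
  no order arrives after \<open>CIOPT\<close>. The picker has moved at unit speed from the depot, so this
  bounds her distance from it as well: \<open>11 = 2 + 3 * 2 + 2 + 1\<close>.\<close>
theorem reopt_competitive: "reopt w sys sel I \<le> 11 * ciopt w sys I"
proof -
  let ?c = "ciopt w sys I"
  obtain bs where bs: "solution w I bs" "duration w sys (depot w) (steps bs) \<le> ?c"
    using optimal_duration by blast
  obtain s where s: "online_inv s" "clock s = 0 \<or> (\<exists>x\<in>set I. clock s \<le> fst x + ?c)"
    "reopt w sys sel I \<le> clock s + 3 * d (depot w) (pos s) + 2 * ?c + duration w sys (depot w) (steps bs)"
    using reopt_le[OF tourable_ciopt ciopt_nonneg bs(1)] by blast
  have "clock s \<le> 2 * ?c"
    using s(2)
  proof
    assume "\<exists>x\<in>set I. clock s \<le> fst x + ?c"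
    then obtain x where "x \<in> set I" "clock s \<le> fst x + ?c" by blast
    then show ?thesis using release_le_ciopt[of x] by linarith
  qed (use ciopt_nonneg in simp)
  then show ?thesis using s(3) d_depot_pos_le_clock[OF s(1)] bs(2) by linarith
qed

theorem reopt_le_ciopt_plus_const:
  assumes "\<And>x. x \<in> set I \<Longrightarrow> fst x \<le> t" "0 \<le> t"
  shows "reopt w sys sel I \<le> t + (3 * diam + 3 * tour_const) + ciopt w sys I"
proof -
  let ?c = "ciopt w sys I"
  obtain bs where bs: "solution w I bs" "duration w sys (depot w) (steps bs) \<le> ?c"
    using optimal_duration by blast
  obtain s where s: "online_inv s" "clock s = 0 \<or> (\<exists>x\<in>set I. clock s \<le> fst x + tour_const)"
    "reopt w sys sel I \<le> clock s + 3 * d (depot w) (pos s) + 2 * tour_const + duration w sys (depot w) (steps bs)"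
    using reopt_le[OF tourable_exists tour_const_nonneg bs(1)] by blast
  have "clock s \<le> t + tour_const"
    using s(2)
  proof
    assume "\<exists>x\<in>set I. clock s \<le> fst x + tour_const"
    then obtain x where "x \<in> set I" "clock s \<le> fst x + tour_const" by blast
    then show ?thesis using assms(1)[of x] by linarith
  qed (use assms(2) tour_const_nonneg in simp)
  moreover have "d (depot w) (pos s) \<le> diam"
    using s(1) depot_grid by (intro d_le_diam) (simp_all add: online_inv_def)
  ultimately show ?thesis using s(3) bs(2) by linarith
qed

text \<open>Here every batch has duration zero, so that \<open>B = 0\<close>.\<close>
theorem reopt_eq_ciopt_at_depot:
  assumes sys: "sys \<noteq> Robot" and at: "snd ` items I \<subseteq> {depot w}"
  shows "reopt w sys sel I = ciopt w sys I"
proof (rule antisym)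
  let ?c = "ciopt w sys I"
  have T: "tourable sys (items I) 0"
    unfolding tourable_def
  proof (intro allI impI)
    fix Q assume Q: "Q \<subseteq> items I"
    then have "finite Q" using finite_items by (rule finite_subset)
    from finite_distinct_list[OF this] obtain xs where xs: "set xs = Q" "distinct xs" by blast
    have "duration w sys (depot w) (map Pick xs @ [Close]) = 0"
      by (rule duration_at_depot[OF sys]) (use xs(1) Q at in auto)
    then show "\<exists>xs. distinct xs \<and> set xs = Q \<and> duration w sys (depot w) (map Pick xs @ [Close]) \<le> 0"
      using xs by (intro exI[of _ xs]) simp
  qed
  obtain bs where bs: "solution w I bs" using solution_exists by blast
  have items: "set (concat bs) = items I" using bs by (simp add: solution_def batching_def)
  have "duration w sys (depot w) (steps bs) = 0"
    by (rule duration_at_depot[OF sys]) (use items at in \<open>unfold Pick_in_steps, blast\<close>)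
  moreover obtain s where s: "online_inv s" "clock s = 0 \<or> (\<exists>x\<in>set I. clock s \<le> fst x + 0)"
    "reopt w sys sel I \<le> clock s + 3 * d (depot w) (pos s) + 2 * 0 + duration w sys (depot w) (steps bs)"
    using reopt_le[OF T order_refl bs] by blast
  moreover have "d (depot w) (pos s) = 0" using s(1) sys at depot_grid by (simp add: online_inv_def)
  moreover have "clock s \<le> ?c"
    using s(2)
  proof
    assume "\<exists>x\<in>set I. clock s \<le> fst x + 0"
    then obtain x where "x \<in> set I" "clock s \<le> fst x" by auto
    then show ?thesis using release_le_ciopt[of x] by linarith
  qed (use ciopt_nonneg in simp)
  ultimately show "reopt w sys sel I \<le> ?c" by linarith
qed (rule ciopt_le_reopt)

end

section \<open>A lower bound by the number of spread orders\<close>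

text \<open>A batch that contains such an order takes time at least \<open>\<delta>\<close> from wherever it
  starts, also if its first item is picked on the spot: two locations of the order have to be visited or,
  with a pushcart, one location and the depot at the end.\<close>
definition spread :: "warehouse \<Rightarrow> system \<Rightarrow> real \<Rightarrow> order \<Rightarrow> bool" where
  "spread w sys \<delta> ps \<longleftrightarrow> (\<exists>p\<in>set ps. (\<exists>q\<in>set ps. \<delta> \<le> dist p q) \<or> sys \<noteq> Robot \<and> \<delta> \<le> dist (depot w) p)"

lemma unsplit_same:
  assumes "unsplit bs" "b \<in> set bs" "b' \<in> set bs" "j \<in> orders_of b" "j \<in> orders_of b'"
  shows "b = b'"
  using assms by (induction bs) auto

context order_instance
begin

lemma spread_batch_long:
  assumes "p \<in> G" "set b \<subseteq> items I" "Pair j ` set ps \<subseteq> set b" "spread w sys \<delta> ps"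
  shows "\<delta> \<le> duration w sys p (steps [b])"
proof -
  have st: "steps [b] = map Pick b @ [Close]" by simp
  have "snd ` set b \<subseteq> G" using assms(2) items_grid by blast
  then have g: "on_grid (map Pick b)" by simp
  have g': "on_grid (map Pick b @ [Close])" using g by simp
  have pk: "Pick (j, q) \<in> set (map Pick b)" if "q \<in> set ps" for q
    using assms(3) that by auto
  obtain q where q: "q \<in> set ps" "(\<exists>q'\<in>set ps. \<delta> \<le> dist q q') \<or> sys \<noteq> Robot \<and> \<delta> \<le> dist (depot w) q"
    using assms(4) unfolding spread_def by blast
  from q(2) show ?thesis
  proof
    assume "\<exists>q'\<in>set ps. \<delta> \<le> dist q q'"
    then obtain q' where q': "q' \<in> set ps" "\<delta> \<le> dist q q'" by blast
    have "dist (snd (j, q)) (snd (j, q')) \<le> duration w sys p (map Pick b @ [Close])"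
      by (rule dist_le_duration_picks[OF assms(1) g']) (use pk[OF q(1)] pk[OF q'(1)] in auto)
    then show ?thesis unfolding st using q'(2) by simp
  next
    assume s: "sys \<noteq> Robot \<and> \<delta> \<le> dist (depot w) q"
    then have "dist (depot w) (snd (j, q)) \<le> duration w sys p (map Pick b @ [Close])"
      by (intro dist_le_duration_depot[OF assms(1) g _ pk[OF q(1)]]) simp
    then show ?thesis unfolding st using s by simp
  qed
qed

lemma spread_batches_long:
  assumes "p \<in> G" "0 \<le> \<delta>"
    and "\<And>b. b \<in> set bs \<Longrightarrow> set b \<subseteq> items I \<and> card (orders_of b) \<le> capacity w"
    and "\<And>b j. b \<in> set bs \<Longrightarrow> j \<in> orders_of b \<Longrightarrow> j \<in> S \<Longrightarrow>
      Pair j ` set (snd (I ! j)) \<subseteq> set b \<and> spread w sys \<delta> (snd (I ! j))"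
  shows "\<delta> * real (card (S \<inter> (\<Union>b\<in>set bs. orders_of b))) \<le> real (capacity w) * duration w sys p (steps bs)"
  using assms(1,3,4)
proof (induction bs arbitrary: p)
  case (Cons b bs)
  define q where "q = stop sys p (steps [b])"
  have b: "set b \<subseteq> items I" "card (orders_of b) \<le> capacity w" using Cons.prems(2)[of b] by simp_all
  have "snd ` set b \<subseteq> G" using b(1) items_grid by blast
  then have g: "on_grid (steps [b])" by simp
  have q: "q \<in> G" unfolding q_def by (rule stop_grid[OF Cons.prems(1) g])
  have IH: "\<delta> * real (card (S \<inter> (\<Union>b\<in>set bs. orders_of b))) \<le> real (capacity w) * duration w sys q (steps bs)"
    by (rule Cons.IH[OF q]) (rule Cons.prems(2), simp, rule Cons.prems(3), simp_all)
  have B: "\<delta> * real (card (S \<inter> orders_of b)) \<le> real (capacity w) * duration w sys p (steps [b])"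
  proof (cases "S \<inter> orders_of b = {}")
    case True
    then show ?thesis using duration_nonneg[OF Cons.prems(1) g, of sys] by simp
  next
    case False
    then obtain j where j: "j \<in> S" "j \<in> orders_of b" by blast
    have jb: "Pair j ` set (snd (I ! j)) \<subseteq> set b \<and> spread w sys \<delta> (snd (I ! j))"
      by (rule Cons.prems(3)[of b, OF _ j(2,1)]) simp
    have "\<delta> \<le> duration w sys p (steps [b])"
      using jb by (intro spread_batch_long[OF Cons.prems(1) b(1)]) blast+
    moreover have "card (S \<inter> orders_of b) \<le> capacity w"
      by (rule order_trans[OF card_mono b(2)]) auto
    ultimately have "real (card (S \<inter> orders_of b)) * \<delta> \<le> real (capacity w) * duration w sys p (steps [b])"
      using assms(2) by (intro mult_mono) simp_all
    then show ?thesis by (simp add: mult.commute)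
  qed
  have "card (S \<inter> (\<Union>b\<in>set (b # bs). orders_of b)) \<le> card (S \<inter> orders_of b) + card (S \<inter> (\<Union>b\<in>set bs. orders_of b))"
  proof -
    have "S \<inter> (\<Union>b\<in>set (b # bs). orders_of b) = (S \<inter> orders_of b) \<union> (S \<inter> (\<Union>b\<in>set bs. orders_of b))" by auto
    then show ?thesis using card_Un_le by metis
  qed
  then have "real (card (S \<inter> (\<Union>b\<in>set (b # bs). orders_of b))) \<le> real (card (S \<inter> orders_of b)) + real (card (S \<inter> (\<Union>b\<in>set bs. orders_of b)))"
    unfolding of_nat_add[symmetric] of_nat_le_iff .
  from mult_left_mono[OF this assms(2)]
  have "\<delta> * real (card (S \<inter> (\<Union>b\<in>set (b # bs). orders_of b)))
    \<le> real (capacity w) * (duration w sys p (steps [b]) + duration w sys q (steps bs))"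
    using IH B by (simp only: distrib_left)
  moreover have "duration w sys p (steps (b # bs)) = duration w sys p (steps [b]) + duration w sys q (steps bs)"
    unfolding q_def duration_append[symmetric] by simp
  ultimately show ?case by simp
qed simp

text \<open>Orders are not split and a batch holds at most \<open>capacity w\<close> of them, so there are
  at least as many batches of duration \<open>\<delta>\<close> as the number of spread orders divided by the
  capacity.\<close>
theorem ciopt_ge_spread:
  assumes "0 \<le> \<delta>"
  shows "\<delta> * real (card {j. j < length I \<and> spread w sys \<delta> (snd (I ! j))}) \<le> real (capacity w) * ciopt w sys I"
proof -
  let ?S = "{j. j < length I \<and> spread w sys \<delta> (snd (I ! j))}"
  obtain bs where bs: "solution w I bs" "duration w sys (depot w) (steps bs) \<le> ciopt w sys I"
    using optimal_duration by blast
  have b: "set (concat bs) = items I" "unsplit bs" "\<And>b. b \<in> set bs \<Longrightarrow> card (orders_of b) \<le> capacity w"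
    using bs(1) by (simp_all add: solution_def batching_def)
  have "?S \<subseteq> (\<Union>b\<in>set bs. orders_of b)"
  proof
    fix j assume j: "j \<in> ?S"
    then have "snd (I ! j) \<noteq> []" using valid_orders[of "I ! j"] by (simp add: valid_order_def)
    then have "(j, hd (snd (I ! j))) \<in> set (concat bs)" unfolding b(1) using j by (simp add: items_def)
    then show "j \<in> (\<Union>b\<in>set bs. orders_of b)" by (force simp: orders_of_def)
  qed
  then have "\<delta> * real (card ?S) = \<delta> * real (card (?S \<inter> (\<Union>b\<in>set bs. orders_of b)))"
    by (simp add: Int_absorb2)
  also have "\<dots> \<le> real (capacity w) * duration w sys (depot w) (steps bs)"
  proof (rule spread_batches_long[OF depot_grid assms])
    fix b0 assume b0: "b0 \<in> set bs"
    then have "set b0 \<subseteq> set (concat bs)" by auto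
    then show "set b0 \<subseteq> items I \<and> card (orders_of b0) \<le> capacity w" using b(1) b(3)[OF b0] by simp
    fix j assume j: "j \<in> orders_of b0" "j \<in> ?S"
    have "Pair j ` set (snd (I ! j)) \<subseteq> set b0"
    proof
      fix x assume x: "x \<in> Pair j ` set (snd (I ! j))"
      then have "x \<in> set (concat bs)" unfolding b(1) using j(2) by (auto simp: items_def)
      then obtain b1 where b1: "b1 \<in> set bs" "x \<in> set b1" by auto
      then have "j \<in> orders_of b1" using x by (force simp: orders_of_def)
      with unsplit_same[OF b(2) b0 b1(1) j(1)] b1(2) show "x \<in> set b0" by simp
    qed
    then show "Pair j ` set (snd (I ! j)) \<subseteq> set b0 \<and> spread w sys \<delta> (snd (I ! j))" using j(2) by simp
  qed
  also have "\<dots> \<le> real (capacity w) * ciopt w sys I" using bs(2) by (intro mult_left_mono) simp_all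
  finally show ?thesis .
qed

end

section \<open>Random instances\<close>

lemma space_order_space [simp]: "space order_space = UNIV"
  by (simp add: order_space_def)

lemma order_code_measurable:
  "(\<lambda>ps. (length ps, \<lambda>k. if k < length ps then ps ! k else (0, 0))) \<in> measurable order_space
     (count_space UNIV \<Otimes>\<^sub>M (\<Pi>\<^sub>M k\<in>(UNIV :: nat set). (borel :: point measure)))"
  unfolding order_space_def by (rule measurable_vimage_algebra1) (simp add: space_pair_measure space_PiM)

lemma length_measurable [measurable]: "length \<in> measurable order_space (count_space UNIV)"
  using measurable_compose[OF order_code_measurable measurable_fst] by (simp add: comp_def)

lemma location_measurable [measurable]:
  "(\<lambda>ps. if k < length ps then ps ! k else (0, 0)) \<in> borel_measurable order_space"
  using measurable_compose[OF measurable_compose[OF order_code_measurable measurable_snd] measurable_component_singleton[of k UNIV]]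
  by simp

text \<open>Locations are measurable only in the padded form used by the generators of the
  sigma-algebra.\<close>
lemma spread_sets [measurable]: "{ps. spread w sys \<delta> ps} \<in> sets order_space"
proof -
  let ?g = "\<lambda>k ps. if k < length ps then ps ! k else (0, 0) :: point"
  have eq: "spread w sys \<delta> ps \<longleftrightarrow> (\<exists>i. i < length ps \<and>
      ((\<exists>j. j < length ps \<and> \<delta> \<le> dist (?g i ps) (?g j ps)) \<or> sys \<noteq> Robot \<and> \<delta> \<le> dist (depot w) (?g i ps)))" for ps
  proof -
    have ex: "(\<exists>p\<in>set ps. P p) \<longleftrightarrow> (\<exists>i. i < length ps \<and> P (ps ! i))" for P
      by (metis in_set_conv_nth)
    show ?thesis unfolding spread_def ex by (simp cong: conj_cong)
  qed
  have "Measurable.pred order_space (\<lambda>ps. spread w sys \<delta> ps)"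
    unfolding eq by measurable
  then show ?thesis by (simp add: pred_def)
qed

lemma R_sum: "R j \<omega> = (\<Sum>i\<le>j. interarrival R i \<omega>)"
  by (induction j) (simp_all add: interarrival_def)

locale random_warehouse = warehouse_grid w + prob_space M
  for w :: warehouse and M :: "'w measure" +
  fixes sys :: system and sel :: "situation \<Rightarrow> plan" and t l :: real and D :: "order measure"
    and Ord :: "nat \<Rightarrow> 'w \<Rightarrow> order" and R :: "nat \<Rightarrow> 'w \<Rightarrow> real"
  assumes tie: "tie_breaking w sys sel" and t: "0 < t" and l: "0 < l"
    and stream: "order_stream M l D Ord R"
    and D_valid: "AE ps in D. valid_order w ps"
begin

abbreviation X :: "nat \<Rightarrow> 'w \<Rightarrow> real" where "X \<equiv> interarrival R"
abbreviation I :: "'w \<Rightarrow> inst" where "I \<equiv> random_inst Ord R t"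

text \<open>These properties hold almost surely. They make the arrival times increasing and eventually
  greater than \<open>t\<close>, so that the instance consists of the first orders, and they let the bounds
  for single instances apply.\<close>
definition good :: "'w \<Rightarrow> bool" where
  "good \<omega> \<longleftrightarrow> (\<forall>j. 0 < X j \<omega>) \<and> (\<exists>j. t < X j \<omega>) \<and> (\<forall>j. valid_order w (Ord j \<omega>))"

lemma Ord_indep: "indep_vars (\<lambda>_. order_space) Ord UNIV"
  and D_distr: "distr M order_space (Ord j) = D"
  and X_indep: "indep_vars (\<lambda>_. borel) X UNIV"
  and X_exp: "distributed M lborel (X j) (exponential_density l)"
  using stream unfolding order_stream_def poisson_arrivals_def by blast+

lemma Ord_measurable [measurable]: "Ord j \<in> measurable M order_space"
  using Ord_indep unfolding indep_vars_def2 by blast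

lemma X_measurable [measurable]: "X j \<in> borel_measurable M"
  using distributed_measurable[OF X_exp] by simp

lemma R_measurable [measurable]: "R j \<in> borel_measurable M"
proof -
  have "(\<lambda>\<omega>. \<Sum>i\<le>j. X i \<omega>) \<in> borel_measurable M" by measurable
  then show ?thesis unfolding R_sum[of R, symmetric] .
qed

lemma prob_Ord: "A \<in> sets order_space \<Longrightarrow> prob (Ord j -` A \<inter> space M) = measure D A"
  unfolding D_distr[of j, symmetric] by (rule measure_distr[symmetric]) measurable

lemma D_prob_space: "prob_space D" and sets_D: "sets D = sets order_space"
  unfolding D_distr[of 0, symmetric] by (rule prob_space_distr) simp_all

text \<open>That only finitely many orders arrive up to time \<open>t\<close> follows already from
  independent interarrival times, each of which exceeds \<open>t\<close> with the same positive
  probability.\<close>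
lemma AE_some_long_gap: "AE \<omega> in M. \<exists>j. t < X j \<omega>"
proof -
  let ?p = "1 - exp (- t * l)"
  let ?N = "{\<omega> \<in> space M. \<forall>j. X j \<omega> \<le> t}"
  have p: "0 \<le> ?p" "?p < 1" using t l by simp_all
  have le: "prob ?N \<le> ?p ^ n" for n
  proof (cases "n = 0")
    case False
    have "prob ?N \<le> prob (\<Inter>j\<in>{..<n}. X j -` {..t} \<inter> space M)"
      using False by (intro finite_measure_mono) auto
    also have "\<dots> = (\<Prod>j<n. prob (X j -` {..t} \<inter> space M))"
      using False by (intro indep_varsD[OF X_indep]) auto
    also have "\<dots> = (\<Prod>j<n. ?p)"
    proof (rule prod.cong[OF refl])
      fix j
      have "X j -` {..t} \<inter> space M = {\<omega> \<in> space M. X j \<omega> \<le> t}" by auto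
      then show "prob (X j -` {..t} \<inter> space M) = ?p"
        using exponential_distributedD_le[OF X_exp, of t j] t l by simp
    qed
    finally show ?thesis by simp
  qed simp
  have "(\<lambda>n. ?p ^ n) \<longlonglongrightarrow> 0" using p by (intro LIMSEQ_power_zero) auto
  then have "prob ?N \<le> 0" by (rule LIMSEQ_le_const) (use le in auto)
  then have "prob ?N = 0" using measure_nonneg[of M ?N] by linarith
  moreover have "?N \<in> events" by measurable
  ultimately have "?N \<in> null_sets M" by (simp add: null_sets_def emeasure_eq_measure)
  then have "AE \<omega> in M. \<omega> \<notin> ?N" by (rule AE_not_in)
  then show ?thesis using AE_space by eventually_elim (auto simp: not_le)
qed

lemma AE_good: "AE \<omega> in M. good \<omega>"
proof -
  have "AE \<omega> in M. 0 < X j \<omega>" for j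
  proof -
    have "prob {\<omega> \<in> space M. X j \<omega> \<le> 0} = 0"
      using exponential_distributedD_le[OF X_exp, of 0 j] l by simp
    moreover have "{\<omega> \<in> space M. X j \<omega> \<le> 0} \<in> events" by measurable
    ultimately have "{\<omega> \<in> space M. X j \<omega> \<le> 0} \<in> null_sets M"
      by (simp add: null_sets_def emeasure_eq_measure)
    then have "AE \<omega> in M. \<omega> \<notin> {\<omega> \<in> space M. X j \<omega> \<le> 0}" by (rule AE_not_in)
    then show ?thesis using AE_space by eventually_elim (auto simp: not_le)
  qed
  then have "AE \<omega> in M. \<forall>j. 0 < X j \<omega>" by (simp add: AE_all_countable)
  moreover have "AE \<omega> in M. \<forall>j. valid_order w (Ord j \<omega>)"
    unfolding AE_all_countable
  proof
    fix j
    show "AE \<omega> in M. valid_order w (Ord j \<omega>)"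
      by (rule AE_distrD[OF Ord_measurable[of j], where P = "valid_order w"]) (unfold D_distr, rule D_valid)
  qed
  ultimately show ?thesis using AE_some_long_gap by eventually_elim (simp add: good_def)
qed

lemma good_R:
  assumes "good \<omega>"
  shows R_mono: "i \<le> j \<Longrightarrow> R i \<omega> \<le> R j \<omega>" and R_nonneg: "0 \<le> R j \<omega>" and X_le_R: "X j \<omega> \<le> R j \<omega>"
proof -
  have X0: "0 \<le> X j \<omega>" for j
  proof (rule less_imp_le)
    show "0 < X j \<omega>" using assms unfolding good_def by blast
  qed
  show "R i \<omega> \<le> R j \<omega>" if "i \<le> j"
  proof -
    have "(\<Sum>k\<le>i. X k \<omega>) \<le> (\<Sum>k\<le>j. X k \<omega>)"
      by (rule sum_mono2) (simp, simp add: that, rule X0)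
    then show ?thesis by (simp only: R_sum[of R i] R_sum[of R j])
  qed
  have "0 \<le> (\<Sum>k\<le>j. X k \<omega>)" by (rule sum_nonneg) (rule X0)
  then show "0 \<le> R j \<omega>" by (simp only: R_sum[of R j])
  have "X j \<omega> \<le> (\<Sum>k\<le>j. X k \<omega>)"
    by (rule member_le_sum[of j "{..j}" "\<lambda>k. X k \<omega>"]) (simp, rule X0, simp)
  then show "X j \<omega> \<le> R j \<omega>" by (simp only: R_sum[of R j])
qed

lemma good_arrivals:
  assumes "good \<omega>"
  obtains n where "{j. R j \<omega> \<le> t} = {..<n}"
proof -
  note mono = R_mono[OF assms]
  obtain j0 where "t < X j0 \<omega>" using assms unfolding good_def by blast
  with X_le_R[OF assms, of j0] have j0: "t < R j0 \<omega>" by linarith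
  define n where "n = (LEAST j. t < R j \<omega>)"
  have n: "t < R n \<omega>" unfolding n_def using j0 by (rule LeastI)
  have "R j \<omega> \<le> t \<longleftrightarrow> j < n" for j
  proof
    assume "R j \<omega> \<le> t"
    then have "\<not> R n \<omega> \<le> R j \<omega>" using n by linarith
    then have "\<not> n \<le> j" using mono by blast
    then show "j < n" by simp
  next
    assume "j < n"
    then have "\<not> t < R j \<omega>" unfolding n_def by (rule not_less_Least)
    then show "R j \<omega> \<le> t" by simp
  qed
  then have "{j. R j \<omega> \<le> t} = {..<n}" by auto
  then show ?thesis by (rule that)
qed

lemma good_instance:
  assumes g: "good \<omega>"
  shows "order_instance w sys sel (I \<omega>)" and "\<And>x. x \<in> set (I \<omega>) \<Longrightarrow> fst x \<le> t"
    and "R j \<omega> \<le> t \<longleftrightarrow> j < length (I \<omega>)"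
    and "j < length (I \<omega>) \<Longrightarrow> snd (I \<omega> ! j) = Ord j \<omega>"
proof -
  obtain n where n: "{j. R j \<omega> \<le> t} = {..<n}" using good_arrivals[OF g] .
  have I: "I \<omega> = map (\<lambda>j. (R j \<omega>, Ord j \<omega>)) [0..<n]" by (simp add: random_inst_def n)
  note mono = R_mono[OF g] and R0 = R_nonneg[OF g]
  have jn: "R j \<omega> \<le> t \<longleftrightarrow> j < n" for j using n by (auto simp: set_eq_iff)
  then show "R j \<omega> \<le> t \<longleftrightarrow> j < length (I \<omega>)" by (simp add: I)
  have mem: "\<exists>j<n. x = (R j \<omega>, Ord j \<omega>)" if "x \<in> set (I \<omega>)" for x
    using that unfolding I by auto
  show "fst x \<le> t" if x: "x \<in> set (I \<omega>)" for x
  proof -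
    obtain j where "j < n" "x = (R j \<omega>, Ord j \<omega>)" using mem[OF x] by blast
    then show ?thesis using jn[of j] by simp
  qed
  show "j < length (I \<omega>) \<Longrightarrow> snd (I \<omega> ! j) = Ord j \<omega>" by (simp add: I)
  show "order_instance w sys sel (I \<omega>)"
  proof
    show "tie_breaking w sys sel" by (rule tie)
    have "sorted (map (\<lambda>j. R j \<omega>) [0..<n])"
      unfolding sorted_map by (rule sorted_wrt_mono_rel[OF _ sorted_upt]) (rule mono)
    then show "sorted (map fst (I \<omega>))" by (simp add: I comp_def)
    show "0 \<le> fst x" "valid_order w (snd x)" if x: "x \<in> set (I \<omega>)" for x
    proof -
      obtain j where j: "j < n" "x = (R j \<omega>, Ord j \<omega>)" using mem[OF x] by blast
      show "0 \<le> fst x" using R0[of j] j(2) by simp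
      show "valid_order w (snd x)" using g unfolding good_def j(2) snd_conv by blast
    qed
  qed
qed

definition quotient :: "'w \<Rightarrow> real" where
  "quotient \<omega> = ratio (reopt w sys sel (I \<omega>)) (ciopt w sys (I \<omega>))"

lemma good_quotient:
  assumes g: "good \<omega>"
  shows "1 \<le> quotient \<omega>" "quotient \<omega> \<le> 11"
proof -
  interpret order_instance w sys sel "I \<omega>" by (rule good_instance[OF g])
  have "1 \<le> quotient \<omega> \<and> quotient \<omega> \<le> 11"
    using ciopt_nonneg ciopt_le_reopt reopt_competitive
    by (cases "ciopt w sys (I \<omega>) = 0") (auto simp: quotient_def ratio_def divide_simps)
  then show "1 \<le> quotient \<omega>" "quotient \<omega> \<le> 11" by auto
qed

text \<open>The additive loss of Reopt on instances with arrivals in \<open>[0, t]\<close>.\<close>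
definition slack :: real where "slack = t + (3 * diam + 3 * tour_const)"

lemma slack_nonneg: "0 \<le> slack"
  using t diam_nonneg tour_const_nonneg by (simp add: slack_def)

lemma good_quotient_large:
  assumes g: "good \<omega>" and B: "0 < B" "B \<le> ciopt w sys (I \<omega>)"
  shows "quotient \<omega> \<le> 1 + slack / B"
proof -
  interpret order_instance w sys sel "I \<omega>" by (rule good_instance[OF g])
  let ?c = "ciopt w sys (I \<omega>)"
  have c: "0 < ?c" using B by linarith
  have "reopt w sys sel (I \<omega>) \<le> slack + ?c"
    unfolding slack_def by (rule reopt_le_ciopt_plus_const[OF good_instance(2)[OF g]]) (use t in simp_all)
  then have "quotient \<omega> \<le> (slack + ?c) / ?c"
    using c by (simp add: quotient_def ratio_def divide_right_mono)
  also have "\<dots> = 1 + slack / ?c" using c by (simp add: field_simps)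
  also have "slack / ?c \<le> slack / B" using B slack_nonneg by (intro divide_left_mono) simp_all
  finally show ?thesis by simp
qed

text \<open>The first \<open>m * k\<close> orders are cut into \<open>m\<close> blocks of length
  \<open>k\<close>; in this event some block has no order in \<open>A\<close>. Otherwise at least
  \<open>m\<close> of these orders belong to \<open>A\<close>. Its probability is bounded by independence
  within each block and a union bound over the blocks.\<close>
definition some_dull_block :: "order set \<Rightarrow> nat \<Rightarrow> nat \<Rightarrow> 'w set" where
  "some_dull_block A m k = (\<Union>i<m. \<Inter>j\<in>{i*k..<i*k+k}. Ord j -` (- A) \<inter> space M)"

lemma some_dull_block_prob:
  assumes A: "A \<in> sets order_space" and k: "0 < k"
  shows "some_dull_block A m k \<in> events" "prob (some_dull_block A m k) \<le> real m * (1 - measure D A) ^ k"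
proof -
  interpret D: prob_space D by (rule D_prob_space)
  have A': "- A \<in> sets order_space" using sets.compl_sets[OF A] by (simp add: Compl_eq_Diff_UNIV)
  have "measure D (space D - A) = 1 - measure D A" by (rule D.prob_compl) (simp add: sets_D A)
  moreover have "space D = UNIV" using sets_eq_imp_space_eq[OF sets_D] by simp
  ultimately have q: "measure D (- A) = 1 - measure D A" by (simp add: Compl_eq_Diff_UNIV)
  let ?E = "\<lambda>i. \<Inter>j\<in>{i*k..<i*k+k}. Ord j -` (- A) \<inter> space M"
  have E: "?E i \<in> events" for i
    using k A' by (intro sets.finite_INT) auto
  then show "some_dull_block A m k \<in> events" unfolding some_dull_block_def by (intro sets.finite_UN) auto
  have pE: "prob (?E i) = (1 - measure D A) ^ k" for i
  proof -
    have "prob (?E i) = (\<Prod>j\<in>{i*k..<i*k+k}. prob (Ord j -` (- A) \<inter> space M))"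
      using k A' by (intro indep_varsD[OF Ord_indep]) auto
    also have "\<dots> = (1 - measure D A) ^ k" by (simp add: prob_Ord[OF A'] q)
    finally show ?thesis .
  qed
  have "prob (some_dull_block A m k) \<le> (\<Sum>i<m. prob (?E i))"
    unfolding some_dull_block_def using E by (intro finite_measure_subadditive_finite) auto
  then show "prob (some_dull_block A m k) \<le> real m * (1 - measure D A) ^ k" unfolding pE by simp
qed

text \<open>If \<open>R N\<close> exceeds \<open>t\<close>, then one of the \<open>N + 1\<close>
  interarrival times that add up to it exceeds \<open>t / (N + 1)\<close>.\<close>
lemma late_prob: "prob {\<omega> \<in> space M. t < R N \<omega>} \<le> real (Suc N) * exp (- (t / real (Suc N)) * l)"
proof -
  let ?a = "t / real (Suc N)"
  have a: "0 \<le> ?a" using t by simp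
  have "{\<omega> \<in> space M. t < R N \<omega>} \<subseteq> (\<Union>i\<le>N. {\<omega> \<in> space M. ?a < X i \<omega>})"
  proof
    fix \<omega> assume \<omega>: "\<omega> \<in> {\<omega> \<in> space M. t < R N \<omega>}"
    have "\<exists>i\<le>N. ?a < X i \<omega>"
    proof (rule ccontr)
      assume "\<not> (\<exists>i\<le>N. ?a < X i \<omega>)"
      then have "(\<Sum>i\<le>N. X i \<omega>) \<le> (\<Sum>i\<le>N. ?a)" by (intro sum_mono) (simp add: not_less)
      also have "\<dots> = t" by simp
      finally show False using \<omega> unfolding R_sum[of R, symmetric] by simp
    qed
    then show "\<omega> \<in> (\<Union>i\<le>N. {\<omega> \<in> space M. ?a < X i \<omega>})" using \<omega> by auto
  qed
  then have "prob {\<omega> \<in> space M. t < R N \<omega>} \<le> prob (\<Union>i\<le>N. {\<omega> \<in> space M. ?a < X i \<omega>})"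
    by (rule finite_measure_mono) measurable
  also have "\<dots> \<le> (\<Sum>i\<le>N. prob {\<omega> \<in> space M. ?a < X i \<omega>})"
    by (intro finite_measure_subadditive_finite) auto
  also have "\<dots> = (\<Sum>i\<le>N. exp (- ?a * l))"
    by (intro sum.cong refl exponential_distributedD_gt[OF X_exp a l])
  finally show ?thesis by simp
qed

lemma many_spread_orders:
  assumes g: "good \<omega>" and \<omega>: "\<omega> \<in> space M" "\<omega> \<notin> some_dull_block {ps. spread w sys \<delta> ps} m k" "R (m * k) \<omega> \<le> t"
    and \<delta>: "0 \<le> \<delta>"
  shows "\<delta> * real m \<le> real (capacity w) * ciopt w sys (I \<omega>)"
proof -
  interpret order_instance w sys sel "I \<omega>" by (rule good_instance[OF g])
  let ?S = "{j. j < length (I \<omega>) \<and> spread w sys \<delta> (snd (I \<omega> ! j))}"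
  have len: "m * k < length (I \<omega>)" using \<omega>(3) good_instance(3)[OF g] by simp
  have "\<exists>j. i * k \<le> j \<and> j < i * k + k \<and> spread w sys \<delta> (Ord j \<omega>)" if "i < m" for i
  proof -
    have "\<omega> \<notin> (\<Inter>j\<in>{i*k..<i*k+k}. Ord j -` (- {ps. spread w sys \<delta> ps}) \<inter> space M)"
      using \<omega>(2) that unfolding some_dull_block_def by blast
    then obtain j where "j \<in> {i*k..<i*k+k}" "\<omega> \<notin> Ord j -` (- {ps. spread w sys \<delta> ps}) \<inter> space M"
      by blast
    then show ?thesis using \<omega>(1) by auto
  qed
  then obtain f where f: "\<And>i. i < m \<Longrightarrow> i * k \<le> f i" "\<And>i. i < m \<Longrightarrow> f i < i * k + k"
    "\<And>i. i < m \<Longrightarrow> spread w sys \<delta> (Ord (f i) \<omega>)" by metis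
  have div: "f i div k = i" if "i < m" for i
    using f(1,2)[OF that] by (intro div_nat_eqI) (simp_all add: mult.commute)
  \<comment> \<open>the chosen orders lie in different blocks\<close>
  then have "inj_on f {..<m}" by (metis inj_onI lessThan_iff)
  moreover have "f ` {..<m} \<subseteq> ?S"
  proof
    fix j assume "j \<in> f ` {..<m}"
    then obtain i where i: "i < m" "j = f i" by auto
    have "j < Suc i * k" using f(2)[OF i(1)] i(2) by (simp add: algebra_simps)
    also have "\<dots> \<le> m * k" using i(1) by (intro mult_right_mono) simp_all
    finally have j: "j < length (I \<omega>)" using len by linarith
    then show "j \<in> ?S" using f(3)[OF i(1)] i(2) good_instance(4)[OF g j] by simp
  qed
  ultimately have "m \<le> card ?S" using card_inj_on_le[of f "{..<m}" ?S] by simp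
  then have "\<delta> * real m \<le> \<delta> * real (card ?S)" using \<delta> by (intro mult_left_mono) simp_all
  also have "\<dots> \<le> real (capacity w) * ciopt w sys (I \<omega>)" by (rule ciopt_ge_spread[OF \<delta>])
  finally show ?thesis .
qed

lemma quotient_integrable:
  assumes "quotient \<in> borel_measurable M"
  shows "integrable M quotient" "1 \<le> expectation quotient"
proof -
  have AE: "AE \<omega> in M. 1 \<le> quotient \<omega> \<and> quotient \<omega> \<le> 11"
    using AE_good by eventually_elim (use good_quotient in blast)
  show *: "integrable M quotient"
    by (rule integrable_const_bound[OF _ assms, of 11]) (use AE in \<open>eventually_elim, auto\<close>)
  show "1 \<le> expectation quotient"
    by (rule integral_ge_const[OF *]) (use AE in \<open>eventually_elim, auto\<close>)
qed

text \<open>Outside an event of small probability there are enough spread orders for \<open>CIOPT \<ge>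
  B\<close>; on that event the ratio exceeds 1 by at most 10.\<close>
lemma expectation_quotient_le:
  assumes meas: "quotient \<in> borel_measurable M"
    and \<delta>: "0 < \<delta>" and B: "0 < B" and k: "0 < k"
    and m: "real (capacity w) * B \<le> \<delta> * real m"
  shows "expectation quotient \<le> 1 + slack / B + 10 *
    (real m * (1 - measure D {ps. spread w sys \<delta> ps}) ^ k +
     real (Suc (m * k)) * exp (- (t / real (Suc (m * k))) * l))"
proof -
  let ?A = "{ps. spread w sys \<delta> ps}"
  define bad where "bad = some_dull_block ?A m k \<union> {\<omega> \<in> space M. t < R (m * k) \<omega>}"
  have db: "some_dull_block ?A m k \<in> events" "prob (some_dull_block ?A m k) \<le> real m * (1 - measure D ?A) ^ k"
    by (rule some_dull_block_prob[OF spread_sets k])+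
  have late: "{\<omega> \<in> space M. t < R (m * k) \<omega>} \<in> events" by measurable
  have bad: "bad \<in> events" unfolding bad_def using db late by (intro sets.Un)
  have pb: "prob bad \<le> real m * (1 - measure D ?A) ^ k + real (Suc (m * k)) * exp (- (t / real (Suc (m * k))) * l)"
    unfolding bad_def using measure_Un_le[OF db(1) late] db(2) late_prob[of "m * k"] by linarith
  have AE: "AE \<omega> in M. quotient \<omega> \<le> (1 + slack / B) + 10 * indicator bad \<omega>"
    using AE_good AE_space
  proof eventually_elim
    fix \<omega> assume g: "good \<omega>" and \<omega>: "\<omega> \<in> space M"
    have s: "0 \<le> slack / B" using slack_nonneg B by simp
    show "quotient \<omega> \<le> (1 + slack / B) + 10 * indicator bad \<omega>"
    proof (cases "\<omega> \<in> bad")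
      case True
      then show ?thesis using good_quotient(2)[OF g] s by simp
    next
      case False
      then have "\<omega> \<notin> some_dull_block ?A m k" "R (m * k) \<omega> \<le> t" using \<omega> by (auto simp: bad_def)
      from many_spread_orders[OF g \<omega> this] \<delta> m
      have "real (capacity w) * B \<le> real (capacity w) * ciopt w sys (I \<omega>)" by simp
      then have "B \<le> ciopt w sys (I \<omega>)" using cap_pos by simp
      then show ?thesis using good_quotient_large[OF g B] False by simp
    qed
  qed
  have ind: "integrable M (\<lambda>\<omega>. 10 * indicat_real bad \<omega>)"
    using bad by (intro integrable_mult_right integrable_real_indicator) (simp_all add: emeasure_eq_measure)
  have int: "integrable M (\<lambda>\<omega>. (1 + slack / B) + 10 * indicat_real bad \<omega>)"
    by (rule Bochner_Integration.integrable_add[OF integrable_const ind])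
  have "expectation quotient \<le> expectation (\<lambda>\<omega>. (1 + slack / B) + 10 * indicator bad \<omega>)"
    by (rule integral_mono_AE[OF quotient_integrable(1)[OF meas] int AE])
  also have "\<dots> = expectation (\<lambda>\<omega>. 1 + slack / B) + expectation (\<lambda>\<omega>. 10 * indicat_real bad \<omega>)"
    by (rule Bochner_Integration.integral_add[OF integrable_const ind])
  also have "\<dots> = 1 + slack / B + 10 * prob bad"
    using bad by (simp add: prob_space)
  also have "\<dots> \<le> 1 + slack / B + 10 *
    (real m * (1 - measure D ?A) ^ k + real (Suc (m * k)) * exp (- (t / real (Suc (m * k))) * l))"
    by (intro add_left_mono mult_left_mono pb) simp
  finally show ?thesis .
qed

lemma quotient_at_depot:
  assumes sys: "sys \<noteq> Robot" and at: "AE ps in D. set ps \<subseteq> {depot w}"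
    and meas: "quotient \<in> borel_measurable M"
  shows "expectation quotient = 1"
proof -
  have "AE \<omega> in M. \<forall>j. set (Ord j \<omega>) \<subseteq> {depot w}"
    unfolding AE_all_countable
  proof
    fix j
    show "AE \<omega> in M. set (Ord j \<omega>) \<subseteq> {depot w}"
      by (rule AE_distrD[OF Ord_measurable[of j], where P = "\<lambda>ps. set ps \<subseteq> {depot w}"]) (unfold D_distr, rule at)
  qed
  then have "AE \<omega> in M. quotient \<omega> = 1"
    using AE_good
  proof eventually_elim
    fix \<omega> assume o: "\<forall>j. set (Ord j \<omega>) \<subseteq> {depot w}" and g: "good \<omega>"
    interpret order_instance w sys sel "I \<omega>" by (rule good_instance[OF g])
    have "snd x = depot w" if "x \<in> items (I \<omega>)" for x
    proof -
      have x: "fst x < length (I \<omega>)" "snd x \<in> set (snd (I \<omega> ! fst x))"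
        using that by (auto simp: items_def)
      then have "snd x \<in> set (Ord (fst x) \<omega>)" using good_instance(4)[OF g x(1)] by simp
      then show ?thesis using o by blast
    qed
    then have "snd ` items (I \<omega>) \<subseteq> {depot w}" by blast
    from reopt_eq_ciopt_at_depot[OF sys this] show "quotient \<omega> = 1"
      by (simp add: quotient_def ratio_def)
  qed
  then have "expectation quotient = expectation (\<lambda>_. 1)"
    using meas by (intro integral_cong_AE) simp_all
  then show ?thesis by (simp add: prob_space)
qed

text \<open>If spread orders have probability zero for all \<open>\<delta> = 1 / (n + 1)\<close>, then
  almost surely all relevant points of an order coincide. With a robot the order has one location then, as
  its locations are distinct, contradicting the assumption on the expected number; with a pushcart the
  common point is the depot.\<close>
lemma spread_or_at_depot:
  assumes robot: "sys = Robot \<Longrightarrow> 1 < (\<integral>\<^sup>+ ps. of_nat (length ps) \<partial>D)"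
  shows "(\<exists>\<delta>>0. 0 < measure D {ps. spread w sys \<delta> ps}) \<or> sys \<noteq> Robot \<and> (AE ps in D. set ps \<subseteq> {depot w})"
proof (rule disjCI)
  interpret D: prob_space D by (rule D_prob_space)
  assume no: "\<not> (sys \<noteq> Robot \<and> (AE ps in D. set ps \<subseteq> {depot w}))"
  show "\<exists>\<delta>>0. 0 < measure D {ps. spread w sys \<delta> ps}"
  proof (rule ccontr)
    assume "\<not> (\<exists>\<delta>>0. 0 < measure D {ps. spread w sys \<delta> ps})"
    then have z: "measure D {ps. spread w sys \<delta> ps} = 0" if "\<delta> > 0" for \<delta>
      using that measure_nonneg[of D "{ps. spread w sys \<delta> ps}"] by (metis less_eq_real_def)
    have "AE ps in D. \<not> spread w sys (inverse (real (Suc n))) ps" for n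
    proof -
      have "{ps. spread w sys (inverse (real (Suc n))) ps} \<in> null_sets D"
        using z[of "inverse (real (Suc n))"] by (simp add: null_sets_def sets_D spread_sets D.emeasure_eq_measure)
      then have "AE ps in D. ps \<notin> {ps. spread w sys (inverse (real (Suc n))) ps}" by (rule AE_not_in)
      then show ?thesis by simp
    qed
    then have ns: "AE ps in D. \<forall>n. \<not> spread w sys (inverse (real (Suc n))) ps" by (simp add: AE_all_countable)
    have eqI: "p = q" if "\<And>n. \<not> inverse (real (Suc n)) \<le> dist p q" for p q :: point
    proof (rule ccontr)
      assume "p \<noteq> q"
      then obtain n where "inverse (real (Suc n)) < dist p q" using reals_Archimedean[of "dist p q"] by auto
      then show False using that[of n] by simp
    qed
    show False
    proof (cases "sys = Robot")
      case False
      have "AE ps in D. set ps \<subseteq> {depot w}"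
        using ns
      proof eventually_elim
        fix ps assume n: "\<forall>n. \<not> spread w sys (inverse (real (Suc n))) ps"
        have "depot w = p" if "p \<in> set ps" for p
          by (rule eqI) (use n that False in \<open>unfold spread_def, blast\<close>)
        then show "set ps \<subseteq> {depot w}" by auto
      qed
      with no False show False by simp
    next
      case True
      have "AE ps in D. (of_nat (length ps) :: ennreal) \<le> 1"
        using ns D_valid
      proof eventually_elim
        fix ps assume n: "\<forall>n. \<not> spread w sys (inverse (real (Suc n))) ps" and v: "valid_order w ps"
        have eq: "p = q" if "p \<in> set ps" "q \<in> set ps" for p q
          by (rule eqI) (use n that in \<open>unfold spread_def, blast\<close>)
        have p: "hd ps \<in> set ps" using v by (simp add: valid_order_def)
        have "set ps = {hd ps}" using eq p by blast
        moreover have "card (set ps) = length ps" using v by (intro distinct_card) (simp add: valid_order_def)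
        ultimately show "(of_nat (length ps) :: ennreal) \<le> 1" by simp
      qed
      then have "(\<integral>\<^sup>+ ps. of_nat (length ps) \<partial>D) \<le> (\<integral>\<^sup>+ ps. 1 \<partial>D)" by (rule nn_integral_mono_AE)
      also have "\<dots> = 1" by (simp add: D.emeasure_space_1)
      finally show False using robot[OF True] by simp
    qed
  qed
qed

lemma prob_quotient_ge:
  assumes meas: "quotient \<in> borel_measurable M" and e: "0 < \<epsilon>"
  shows "prob {\<omega> \<in> space M. 1 + \<epsilon> \<le> quotient \<omega>} \<le> (expectation quotient - 1) / \<epsilon>"
proof -
  have int: "integrable M (\<lambda>\<omega>. quotient \<omega> - 1)"
    by (rule Bochner_Integration.integrable_diff[OF quotient_integrable(1)[OF meas] integrable_const])
  have "AE \<omega> in M. 0 \<le> quotient \<omega> - 1"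
    using AE_good by eventually_elim (use good_quotient(1) in simp)
  then have "prob {\<omega> \<in> space M. \<epsilon> \<le> quotient \<omega> - 1} \<le> expectation (\<lambda>\<omega>. quotient \<omega> - 1) / \<epsilon>"
    by (rule integral_Markov_inequality_measure[OF int sets.empty_sets _ e])
  also have "expectation (\<lambda>\<omega>. quotient \<omega> - 1) = expectation quotient - 1"
    using Bochner_Integration.integral_diff[OF quotient_integrable(1)[OF meas] integrable_const[of 1]]
    by (simp add: prob_space)
  also have "{\<omega> \<in> space M. \<epsilon> \<le> quotient \<omega> - 1} = {\<omega> \<in> space M. 1 + \<epsilon> \<le> quotient \<omega>}"
    by (rule Collect_cong) (simp add: le_diff_eq add.commute)
  finally show ?thesis .
qed

end

section \<open>The limit of high arrival rates\<close>

lemma exp_decay: "0 < (c::real) \<Longrightarrow> ((\<lambda>l. exp (- c * l)) \<longlongrightarrow> 0) at_top"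
  by (rule filterlim_compose[OF exp_at_bot filterlim_tendsto_neg_mult_at_bot[OF tendsto_const _ filterlim_ident]]) simp

theorem theorem3:
  fixes w :: warehouse and sys :: system and sel :: "situation \<Rightarrow> plan" and t :: real
    and P :: "real \<Rightarrow> 'w measure" and D :: "order measure"
    and Ord :: "nat \<Rightarrow> 'w \<Rightarrow> order" and R :: "nat \<Rightarrow> 'w \<Rightarrow> real"
    and lam :: "nat \<Rightarrow> real"
  assumes "valid_warehouse w"
    and "tie_breaking w sys sel"
    and "0 < t"
    and "\<And>l. 0 < l \<Longrightarrow> order_stream (P l) l D Ord R"
    and "AE ps in D. valid_order w ps"
    and "sys = Robot \<Longrightarrow> 1 < (\<integral>\<^sup>+ ps. of_nat (length ps) \<partial>D)"
    and "\<And>l. 0 < l \<Longrightarrow> (\<lambda>\<omega>. reopt w sys sel (random_inst Ord R t \<omega>)) \<in> borel_measurable (P l)"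
    and "\<And>l. 0 < l \<Longrightarrow> (\<lambda>\<omega>. ciopt w sys (random_inst Ord R t \<omega>)) \<in> borel_measurable (P l)"
    and "\<And>i. 0 < lam i" and "incseq lam" and "filterlim lam at_top sequentially"
  shows "(\<lambda>i. prob_space.expectation (P (lam i))
            (\<lambda>\<omega>. ratio (reopt w sys sel (random_inst Ord R t \<omega>))
                       (ciopt w sys (random_inst Ord R t \<omega>)))) \<longlonglongrightarrow> 1
       \<and> (\<forall>\<epsilon>>0. (\<lambda>i. prob_space.prob (P (lam i))
            {\<omega> \<in> space (P (lam i)).
               ratio (reopt w sys sel (random_inst Ord R t \<omega>))
                     (ciopt w sys (random_inst Ord R t \<omega>)) \<ge> 1 + \<epsilon>}) \<longlonglongrightarrow> 0)"
proof -
  define \<rho> where "\<rho> \<omega> = ratio (reopt w sys sel (random_inst Ord R t \<omega>)) (ciopt w sys (random_inst Ord R t \<omega>))" for \<omega>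
  have rw: "random_warehouse w (P l) sys sel t l D Ord R" if "0 < l" for l
    using assms(1-3,5) assms(4)[OF that] that
    by (intro random_warehouse.intro warehouse_grid.intro random_warehouse_axioms.intro) (auto simp: order_stream_def)
  have \<rho>: "random_warehouse.quotient w sys sel t Ord R = \<rho>"
    using random_warehouse.quotient_def[OF rw[of 1]] by (simp add: \<rho>_def fun_eq_iff)
  have \<rho>_meas: "\<rho> \<in> borel_measurable (P l)" if "0 < l" for l
    using assms(7,8)[OF that] unfolding \<rho>_def ratio_def by measurable
  note rl = rw[OF assms(9)] and ml = \<rho>_meas[OF assms(9)]
  define E where "E i = prob_space.expectation (P (lam i)) \<rho>" for i
  have E_ge: "1 \<le> E i" for i
    using random_warehouse.quotient_integrable(2)[OF rl, unfolded \<rho>, OF ml] by (simp add: E_def)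
  have E_lim: "E \<longlonglongrightarrow> 1"
  proof -
    from random_warehouse.spread_or_at_depot[OF rw[of 1] assms(6)]
    consider \<delta> where "\<delta> > 0" "0 < measure D {ps. spread w sys \<delta> ps}"
      | "sys \<noteq> Robot" "AE ps in D. set ps \<subseteq> {depot w}" by auto
    then show ?thesis
    proof cases
      case 2
      have "E i = 1" for i
        using random_warehouse.quotient_at_depot[OF rl 2, unfolded \<rho>, OF ml] by (simp add: E_def)
      then have "E = (\<lambda>_. 1)" by (rule ext)
      then show ?thesis by simp
    next
      case (1 \<delta>)
      define q where "q = measure D {ps. spread w sys \<delta> ps}"
      define K where "K = random_warehouse.slack w t"
      have K: "0 \<le> K" unfolding K_def by (rule random_warehouse.slack_nonneg[OF rw[of 1]]) simp
      have q: "0 < q" "q \<le> 1"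
        using 1(2) prob_space.prob_le_1[OF random_warehouse.D_prob_space[OF rw[of 1]]] by (simp_all add: q_def)
      have ev: "eventually (\<lambda>i. E i < 1 + e) sequentially" if e: "0 < e" for e
      proof -
        \<comment> \<open>three contributions below \<open>e / 3\<close>: the additive loss relative to
          \<open>B\<close>, blocks without spread orders, late arrivals; \<open>B\<close>, \<open>m\<close>
          and \<open>k\<close> are chosen in this order, and only the last contribution depends on the
          rate\<close>
        define B where "B = 3 * (K + 1) / e"
        have B: "0 < B" using K e by (simp add: B_def)
        have KB: "K / B < e / 3"
          using K e by (simp add: B_def field_simps)
        obtain m where "real (capacity w) * B / \<delta> \<le> real m" using real_arch_simple by blast
        then have m: "real (capacity w) * B \<le> \<delta> * real m" using 1(1) by (simp add: field_simps)
        have "(\<lambda>k. 10 * (real m * (1 - q) ^ k)) \<longlonglongrightarrow> 10 * (real m * 0)"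
          using q by (intro tendsto_intros LIMSEQ_power_zero) auto
        then have "eventually (\<lambda>k. 10 * (real m * (1 - q) ^ k) < e / 3) sequentially"
          by (rule order_tendstoD) (use e in simp)
        with eventually_gt_at_top[of "0::nat"]
        have "eventually (\<lambda>k. 0 < k \<and> 10 * (real m * (1 - q) ^ k) < e / 3) sequentially"
          by (rule eventually_conj)
        then obtain k where k: "0 < k" "10 * (real m * (1 - q) ^ k) < e / 3"
          using eventually_happens'[OF sequentially_bot] by blast
        define N where "N = real (Suc (m * k))"
        have N: "0 < N" by (simp only: N_def of_nat_0_less_iff zero_less_Suc)
        have "((\<lambda>l. 10 * (N * exp (- (t / N) * l))) \<longlongrightarrow> 10 * (N * 0)) at_top"
          using assms(3) N by (intro tendsto_mult tendsto_const exp_decay) simp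
        then have "((\<lambda>i. 10 * (N * exp (- (t / N) * lam i))) \<longlongrightarrow> 10 * (N * 0)) sequentially"
          by (rule filterlim_compose[OF _ assms(11)])
        then have "eventually (\<lambda>i. 10 * (N * exp (- (t / N) * lam i)) < e / 3) sequentially"
          by (rule order_tendstoD) (use e in simp)
        then show ?thesis
        proof eventually_elim
          fix i assume i: "10 * (N * exp (- (t / N) * lam i)) < e / 3"
          have "E i \<le> 1 + K / B + 10 * (real m * (1 - q) ^ k + N * exp (- (t / N) * lam i))"
            using random_warehouse.expectation_quotient_le[OF rl, unfolded \<rho>, OF ml 1(1) B k(1) m]
            unfolding E_def q_def K_def N_def .
          then show "E i < 1 + e" using i k(2) KB unfolding distrib_left by linarith
        qed
      qed
      show ?thesis
      proof (rule order_tendstoI)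
        show "eventually (\<lambda>i. a < E i) sequentially" if "a < 1" for a
          by (intro always_eventually allI less_le_trans[OF that E_ge])
        show "eventually (\<lambda>i. E i < a) sequentially" if "1 < a" for a
          using ev[of "a - 1"] that by simp
      qed
    qed
  qed
  have "(\<lambda>i. prob_space.prob (P (lam i)) {\<omega> \<in> space (P (lam i)). 1 + \<epsilon> \<le> \<rho> \<omega>}) \<longlonglongrightarrow> 0" if e: "0 < \<epsilon>" for \<epsilon>
  proof (rule tendsto_sandwich[OF _ _ tendsto_const])
    show "(\<lambda>i. (E i - 1) / \<epsilon>) \<longlonglongrightarrow> 0"
      using tendsto_divide[OF tendsto_diff[OF E_lim tendsto_const[of 1]] tendsto_const[of \<epsilon>]] e by simp
    show "eventually (\<lambda>i. prob_space.prob (P (lam i)) {\<omega> \<in> space (P (lam i)). 1 + \<epsilon> \<le> \<rho> \<omega>} \<le> (E i - 1) / \<epsilon>) sequentially"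
      using random_warehouse.prob_quotient_ge[OF rl, unfolded \<rho>, OF ml e] by (simp add: E_def)
  qed simp
  then show ?thesis using E_lim unfolding E_def \<rho>_def by blast
qed

end
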